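(* Let $(X,d)$ be a separable metric space (not necessarily complete) and let $\rho(t,\rho_0,\omega)$ be a time-homogeneous, almost surely continuous, $X$-valued Markov process satisfying assumptions (H1)–(H4) of the context. Then the Markov process is uniquely ergodic, i.e. it has a unique invariant probability measure $\mu^*\in\mathcal P(X)$. Furthermore, it is strongly mixing, i.e. $P_t^*\mu$ converges weakly to $\mu^*$ as $t\to\infty$ for all $\mu\in\mathcal P(X)$.
   Context: $(\Omega,\mathcal F,(\mathcal F_t)_{t\ge0},\mathbb P)$ is a filtered probability space with right-continuous complete filtration. $[0,\infty)\times X\times\Omega\ni(t,\rho_0,\omega)\mapsto\rho(t,\rho_0,\omega)\in X$ is a time-homogeneous a.s. continuous Markov process adapted to $\mathcal F_t$ and started at $\rho_0\in X$, with transition probabilities $P_t(\rho_0,\cdot)\in\mathcal P(X)$; $P_t$ also denotes the semigroup on $C_b(X)$ and $P_t^*$ its adjoint on $\mathcal P(X)$ (Borel probability measures on $X$). All initial conditions are driven on the same probability space, so that for $(\rho_{0,1},\rho_{0,2})\in X\times X$ the two-point process $(\rho(t,\rho_{0,1},\cdot),\rho(t,\rho_{0,2},\cdot))$ is defined. (H1) Non-expansivity: for all $(\rho_{0,1},\rho_{0,2})\in X\times X$, $\mathbb P$-a.s., $d(\rho(t,\rho_{0,1},\omega),\rho(t,\rho_{0,2},\omega))\le d(\rho_{0,1},\rho_{0,2})$ for all $t\ge0$. (H2) Support property: there is a map $u:[0,\infty)\times X\to X$ such that (a) for all $R\ge0$ there is a bounded decreasing function $C_R:[0,\infty)\to[0,\infty)$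 with $\lim_{t\to\infty}C_R(t)=0$ such that for all compact $\mathcal M\subset X$ with $\mathrm{diam}(\mathcal M)=R$, all $\rho_{0,1},\rho_{0,2}\in\mathcal M$ and $t\ge0$: $d(u(t,\rho_{0,1}),u(t,\rho_{0,2}))\le C_R(t)$; (b) for all $\rho_0\in X$, $T>0$ and $\delta>0$: $\mathbb P\big(\int_0^Td(\rho(t,\rho_0,\cdot),u(t,\rho_0))\,dt\le\frac\delta2\big)>0$. (H3) Strong Markov property: for every $\mathcal F_t$-stopping time $\tau$, every bounded Borel $F:X\to\mathbb R$, $\rho_0\in X$ and $t\ge0$, $\mathbb P$-a.s. on $\{\tau<\infty\}$, $\mathbb E(F(\rho(t+\tau,\rho_0,\cdot))|\mathcal F_\tau)(\omega)=\mathbb E(F(\rho(t,\rho(\tau,\rho_0,\omega),\cdot)))$; the same holds for the two-point process on $X\times X$. (H4) Dissipation estimate: there are lower semicontinuous $\Psi_1,\Psi_2:X\to\mathbb R_+$ and $C>0$ such that for all $\rho_0\in X$ and $T\ge0$: $\operatorname{ess\,sup}_{0\le t\le T}\mathbb E(\Psi_1(\rho(t,\rho_0,\cdot)))+\mathbb E\big(\int_0^T\Psi_2(\rho(t,\rho_0,\cdot))\,dt\big)\le C(T+\Psi_1(\rho_0))$; moreover $\Psi_2$ has compact sublevel sets. *)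

theory Defs
  imports "HOL-Probability.Probability"
begin

(* Separability of a metric space is rendered, as in the library class polish_space, by the class
   second_countable_topology; completeness is not assumed. *)

section \<open>Filtered probability spaces and Markov processes\<close>

(* Times of the filtration range over [0, \<infinity>], so that the library's stopping times take values
   in [0, \<infinity>].  F \<infinity> is an arbitrary sigma-algebra containing all F t; its choice
   does not affect stopping times nor the trace of F_tau on {tau < \<infinity>}. *)
locale filtered_prob_space =
  prob_space M + complete_measure M + filtration "space M" F
  for M :: "'w measure" and F :: "ennreal \<Rightarrow> 'w measure" +
  assumes sets_F_subset: "\<And>t. sets (F t) \<subseteq> sets M"
    and right_continuous: "\<And>t. t < \<infinity> \<Longrightarrow> sets (F t) = (\<Inter>s\<in>{t<..}. sets (F s))"
    and complete_F: "null_sets M \<subseteq> sets (F 0)"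

(* rho t x is the time-t value (t \<ge> 0) of the process started at x; all starting points are
   driven on the same space M.  Values at t < 0 are irrelevant. *)
locale markov_process = filtered_prob_space M F
  for M :: "'w measure" and F :: "ennreal \<Rightarrow> 'w measure" +
  fixes \<rho> :: "real \<Rightarrow> 'x::{metric_space, second_countable_topology} \<Rightarrow> 'w \<Rightarrow> 'x"
  assumes adapted: "\<And>t x. 0 \<le> t \<Longrightarrow> \<rho> t x \<in> F (ennreal t) \<rightarrow>\<^sub>M borel"
    and start: "\<And>x. AE \<omega> in M. \<rho> 0 x \<omega> = x"
    and continuous_paths: "\<And>x. AE \<omega> in M. continuous_on {0..} (\<lambda>t. \<rho> t x \<omega>)"
    and markov_property:
      "\<And>s t x f. 0 \<le> s \<Longrightarrow> 0 \<le> t \<Longrightarrow> f \<in> borel_measurable borel \<Longrightarrow> bounded (range f) \<Longrightarrow>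
        AE \<omega> in M. real_cond_exp M (F (ennreal s)) (\<lambda>\<omega>'. f (\<rho> (s + t) x \<omega>')) \<omega>
                   = (\<integral>\<omega>'. f (\<rho> t (\<rho> s x \<omega>) \<omega>') \<partial>M)"


section \<open>Assumptions on the process\<close>

definition non_expansive ::
  "'w measure \<Rightarrow> (real \<Rightarrow> 'x::metric_space \<Rightarrow> 'w \<Rightarrow> 'x) \<Rightarrow> bool" where
  "non_expansive M \<rho> \<longleftrightarrow>
    (\<forall>x y. AE \<omega> in M. \<forall>t\<ge>0. dist (\<rho> t x \<omega>) (\<rho> t y \<omega>) \<le> dist x y)"

(* No measurability of u is assumed, so the existence of the integral is part of the event; the
   measure of a non-measurable set is 0, so positivity includes measurability of the event. *)
definition support_property ::
  "'w measure \<Rightarrow> (real \<Rightarrow> 'x::metric_space \<Rightarrow> 'w \<Rightarrow> 'x) \<Rightarrow> bool" where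
  "support_property M \<rho> \<longleftrightarrow>
    (\<exists>u :: real \<Rightarrow> 'x \<Rightarrow> 'x.
      (\<forall>R\<ge>0. \<exists>C :: real \<Rightarrow> real.
        (\<forall>t\<ge>0. 0 \<le> C t) \<and> bounded (C ` {0..}) \<and> antimono_on {0..} C \<and> (C \<longlongrightarrow> 0) at_top \<and>
        (\<forall>K. compact K \<and> diameter K = R \<longrightarrow>
          (\<forall>x\<in>K. \<forall>y\<in>K. \<forall>t\<ge>0. dist (u t x) (u t y) \<le> C t))) \<and>
      (\<forall>x. \<forall>T>0. \<forall>\<delta>>0.
        measure M {\<omega> \<in> space M.
          integrable (lebesgue_on {0..T}) (\<lambda>t. dist (\<rho> t x \<omega>) (u t x)) \<and>
          (\<integral>t. dist (\<rho> t x \<omega>) (u t x) \<partial>lebesgue_on {0..T}) \<le> \<delta> / 2} > 0))"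

definition strong_markov ::
  "'w measure \<Rightarrow> (ennreal \<Rightarrow> 'w measure) \<Rightarrow>
    (real \<Rightarrow> 'x::{metric_space, second_countable_topology} \<Rightarrow> 'w \<Rightarrow> 'x) \<Rightarrow> bool" where
  "strong_markov M F \<rho> \<longleftrightarrow>
    (\<forall>\<tau> :: 'w \<Rightarrow> ennreal. stopping_time F \<tau> \<longrightarrow>
      (\<forall>f \<in> borel_measurable (borel :: 'x measure). bounded (range f) \<longrightarrow>
        (\<forall>x. \<forall>t\<ge>0. AE \<omega> in M. \<tau> \<omega> < \<infinity> \<longrightarrow>
          real_cond_exp M (filtration.pre_sigma (space M) F \<tau>)
            (\<lambda>\<omega>'. if \<tau> \<omega>' < \<infinity> then f (\<rho> (t + enn2real (\<tau> \<omega>')) x \<omega>') else 0) \<omega>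
          = (\<integral>\<omega>'. f (\<rho> t (\<rho> (enn2real (\<tau> \<omega>)) x \<omega>) \<omega>') \<partial>M))) \<and>
      (\<forall>f \<in> borel_measurable (borel :: ('x \<times> 'x) measure). bounded (range f) \<longrightarrow>
        (\<forall>x y. \<forall>t\<ge>0. AE \<omega> in M. \<tau> \<omega> < \<infinity> \<longrightarrow>
          real_cond_exp M (filtration.pre_sigma (space M) F \<tau>)
            (\<lambda>\<omega>'. if \<tau> \<omega>' < \<infinity>
                  then f (\<rho> (t + enn2real (\<tau> \<omega>')) x \<omega>', \<rho> (t + enn2real (\<tau> \<omega>')) y \<omega>')
                  else 0) \<omega>
          = (\<integral>\<omega>'. f (\<rho> t (\<rho> (enn2real (\<tau> \<omega>)) x \<omega>) \<omega>',
                   \<rho> t (\<rho> (enn2real (\<tau> \<omega>)) y \<omega>) \<omega>') \<partial>M))))"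

definition lower_semicontinuous :: "('x::topological_space \<Rightarrow> real) \<Rightarrow> bool" where
  "lower_semicontinuous f \<longleftrightarrow> (\<forall>x. \<forall>a<f x. \<forall>\<^sub>F y in nhds x. a < f y)"

definition dissipation_estimate ::
  "'w measure \<Rightarrow> (real \<Rightarrow> 'x::topological_space \<Rightarrow> 'w \<Rightarrow> 'x) \<Rightarrow> bool" where
  "dissipation_estimate M \<rho> \<longleftrightarrow>
    (\<exists>(\<Psi>1 :: 'x \<Rightarrow> real) (\<Psi>2 :: 'x \<Rightarrow> real) C.
      (\<forall>x. 0 \<le> \<Psi>1 x) \<and> lower_semicontinuous \<Psi>1 \<and>
      (\<forall>x. 0 \<le> \<Psi>2 x) \<and> lower_semicontinuous \<Psi>2 \<and> C > 0 \<and>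
      (\<forall>x. \<forall>T\<ge>0.
        esssup (lebesgue_on {0..T}) (\<lambda>t. \<integral>\<^sup>+\<omega>. ennreal (\<Psi>1 (\<rho> t x \<omega>)) \<partial>M) +
        (\<integral>\<^sup>+\<omega>. (\<integral>\<^sup>+t. ennreal (\<Psi>2 (\<rho> t x \<omega>)) \<partial>lebesgue_on {0..T}) \<partial>M)
        \<le> ennreal (C * (T + \<Psi>1 x))) \<and>
      (\<forall>c. compact {x. \<Psi>2 x \<le> c}))"


section \<open>Transition probabilities, invariance and weak convergence\<close>

definition transition ::
  "'w measure \<Rightarrow> (real \<Rightarrow> 'x::topological_space \<Rightarrow> 'w \<Rightarrow> 'x) \<Rightarrow> real \<Rightarrow> 'x \<Rightarrow> 'x measure" where
  "transition M \<rho> t x = distr M borel (\<rho> t x)"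

definition dual_semigroup ::
  "'w measure \<Rightarrow> (real \<Rightarrow> 'x::topological_space \<Rightarrow> 'w \<Rightarrow> 'x) \<Rightarrow> real \<Rightarrow> 'x measure \<Rightarrow> 'x measure" where
  "dual_semigroup M \<rho> t \<mu> = \<mu> \<bind> transition M \<rho> t"

definition invariant_prob ::
  "'w measure \<Rightarrow> (real \<Rightarrow> 'x::topological_space \<Rightarrow> 'w \<Rightarrow> 'x) \<Rightarrow> 'x measure \<Rightarrow> bool" where
  "invariant_prob M \<rho> \<mu> \<longleftrightarrow>
    \<mu> \<in> space (prob_algebra borel) \<and> (\<forall>t\<ge>0. dual_semigroup M \<rho> t \<mu> = \<mu>)"

definition weakly_converges ::
  "('i \<Rightarrow> 'x::topological_space measure) \<Rightarrow> 'x measure \<Rightarrow> 'i filter \<Rightarrow> bool" where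
  "weakly_converges \<nu> \<mu> G \<longleftrightarrow>
    (\<forall>f :: 'x \<Rightarrow> real. continuous_on UNIV f \<and> bounded (range f) \<longrightarrow>
      ((\<lambda>i. \<integral>x. f x \<partial>\<nu> i) \<longlongrightarrow> (\<integral>x. f x \<partial>\<mu>)) G)"

(* For a non-expansive process the transition kernels are measurable, so that the Giry bind above is the adjoint
   of the semigroup. *)
lemma (in markov_process) measurable_rho:
  assumes "0 \<le> t" shows "\<rho> t x \<in> M \<rightarrow>\<^sub>M borel"
  using measurable_mono[OF order_refl refl sets_F_subset space_F] adapted[OF assms] by blast

lemma (in markov_process) measurable_transition:
  assumes nonexp: "non_expansive M \<rho>" and t: "0 \<le> t"
  shows "transition M \<rho> t \<in> borel \<rightarrow>\<^sub>M prob_algebra borel"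
proof -
  note rho [measurable] = measurable_rho[OF t]
  interpret T: prob_space "transition M \<rho> t x" for x
    unfolding transition_def by (rule prob_space_distr) (rule rho)
  have closed_meas: "(\<lambda>x. emeasure (transition M \<rho> t x) A) \<in> borel_measurable borel"
    if A: "closed A" for A
  proof (cases "A = {}")
    case True
    then show ?thesis by simp
  next
    case ne: False
    have [measurable]: "A \<in> sets borel"
      using A by (rule borel_closed)
    define g where "g = (\<lambda>(n::nat) y. max 0 (1 - real n * infdist y A))"
    have g_cont: "continuous_on UNIV (g n)" for n
      unfolding g_def by (intro continuous_intros)
    then have [measurable]: "g n \<in> borel_measurable borel" for n
      by (rule borel_measurable_continuous_onI)
    have g_bound: "0 \<le> g n y" "g n y \<le> 1" for n y
      by (auto simp: g_def infdist_nonneg)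
    have g_lip: "\<bar>g n y - g n z\<bar> \<le> real n * dist y z" for n y z
    proof -
      have "\<bar>g n y - g n z\<bar> \<le> \<bar>real n * infdist y A - real n * infdist z A\<bar>"
        unfolding g_def by linarith
      also have "\<dots> = real n * \<bar>infdist y A - infdist z A\<bar>"
        by (simp add: abs_mult flip: right_diff_distrib)
      also have "\<dots> \<le> real n * dist y z"
        using infdist_triangle_abs[of y A z] by (intro mult_left_mono) auto
      finally show ?thesis .
    qed
    have int: "integrable M (\<lambda>\<omega>. g n (\<rho> t x \<omega>))" for n x
      using g_bound by (intro integrable_const_bound[where B=1]) auto
    define h where "h = (\<lambda>n x. \<integral>\<omega>. g n (\<rho> t x \<omega>) \<partial>M)"
    have "dist (h n x) (h n y) \<le> real n * dist x y" for n x y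
    proof -
      have "\<bar>h n x - h n y\<bar> = \<bar>\<integral>\<omega>. g n (\<rho> t x \<omega>) - g n (\<rho> t y \<omega>) \<partial>M\<bar>"
        unfolding h_def by (simp add: int)
      also have "\<dots> \<le> (\<integral>\<omega>. \<bar>g n (\<rho> t x \<omega>) - g n (\<rho> t y \<omega>)\<bar> \<partial>M)"
        by (rule integral_abs_bound)
      also have "\<dots> \<le> (\<integral>\<omega>. real n * dist x y \<partial>M)"
      proof (rule integral_mono_AE)
        show "AE \<omega> in M. \<bar>g n (\<rho> t x \<omega>) - g n (\<rho> t y \<omega>)\<bar> \<le> real n * dist x y"
          using nonexp[unfolded non_expansive_def, rule_format, of x y]
        proof eventually_elim
          case (elim \<omega>)
          have "real n * dist (\<rho> t x \<omega>) (\<rho> t y \<omega>) \<le> real n * dist x y"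
            using elim t by (intro mult_left_mono) auto
          then show ?case using g_lip[of n "\<rho> t x \<omega>" "\<rho> t y \<omega>"] by linarith
        qed
      qed (auto intro!: int)
      finally show ?thesis by (simp add: prob_space dist_real_def)
    qed
    then have "(real n)-lipschitz_on UNIV (h n)" for n
      by (intro lipschitz_onI) auto
    then have "continuous_on UNIV (h n)" for n
      using lipschitz_on_continuous_on by blast
    then have h_meas: "h n \<in> borel_measurable borel" for n
      by (rule borel_measurable_continuous_onI)
    have "(\<lambda>n. h n x) \<longlonglongrightarrow> (\<integral>\<omega>. indicat_real A (\<rho> t x \<omega>) \<partial>M)" for x
      unfolding h_def
    proof (rule integral_dominated_convergence[where w="\<lambda>_. 1"])
      show "AE \<omega> in M. (\<lambda>n. g n (\<rho> t x \<omega>)) \<longlonglongrightarrow> indicator A (\<rho> t x \<omega>)"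
      proof (rule AE_I2)
        fix \<omega>
        show "(\<lambda>n. g n (\<rho> t x \<omega>)) \<longlonglongrightarrow> indicator A (\<rho> t x \<omega>)"
        proof (cases "\<rho> t x \<omega> \<in> A")
          case True
          then show ?thesis by (simp add: g_def)
        next
          case False
          then have pos: "infdist (\<rho> t x \<omega>) A > 0"
            using A ne by (metis infdist_pos_not_in_closed)
          obtain N where N: "1 < real N * infdist (\<rho> t x \<omega>) A"
            using reals_Archimedean3[OF pos] by blast
          have "g n (\<rho> t x \<omega>) = 0" if "n \<ge> N" for n
          proof -
            have "real N * infdist (\<rho> t x \<omega>) A \<le> real n * infdist (\<rho> t x \<omega>) A"
              using that pos by (intro mult_right_mono) auto
            then show ?thesis using N by (simp add: g_def)
          qed
          then have "eventually (\<lambda>n. g n (\<rho> t x \<omega>) = 0) sequentially"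
            by (auto simp: eventually_sequentially)
          with False show ?thesis by (simp add: tendsto_eventually)
        qed
      qed
    qed (use g_bound A in auto)
    then have "(\<lambda>x. \<integral>\<omega>. indicat_real A (\<rho> t x \<omega>) \<partial>M) \<in> borel_measurable borel"
      by (intro borel_measurable_LIMSEQ_real[OF _ h_meas])
    moreover have "emeasure (transition M \<rho> t x) A = ennreal (\<integral>\<omega>. indicat_real A (\<rho> t x \<omega>) \<partial>M)" for x
    proof -
      have "measure (transition M \<rho> t x) A = (\<integral>y. indicat_real A y \<partial>transition M \<rho> t x)"
        by (simp add: transition_def)
      also have "\<dots> = (\<integral>\<omega>. indicat_real A (\<rho> t x \<omega>) \<partial>M)"
        unfolding transition_def using A by (intro integral_distr) auto
      finally show ?thesis by (simp add: T.emeasure_eq_measure)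
    qed
    ultimately show ?thesis by simp
  qed
  have "transition M \<rho> t \<in> borel \<rightarrow>\<^sub>M subprob_algebra borel"
  proof (rule measurable_subprob_algebra_generated[where \<Omega>=UNIV and G="Collect closed"])
    show "sets borel = sigma_sets UNIV (Collect closed)"
      by (simp add: borel_eq_closed)
    show "Int_stable (Collect closed)"
      by (auto simp: Int_stable_def)
    show "subprob_space (transition M \<rho> t a)" for a
      by (rule T.subprob_space_axioms)
    show "(\<lambda>a. emeasure (transition M \<rho> t a) UNIV) \<in> borel_measurable borel"
      using closed_meas by simp
  qed (auto simp: transition_def intro: closed_meas[unfolded transition_def])
  then show ?thesis
    unfolding prob_algebra_def by (intro measurable_restrict_space2) (auto intro: T.prob_space_axioms)
qed

lemma (in markov_process) integral_dual_semigroup: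
  fixes f :: "'x \<Rightarrow> real"
  assumes nonexp: "non_expansive M \<rho>" and t: "0 \<le> t"
    and mu: "\<mu> \<in> space (prob_algebra borel)"
    and f: "f \<in> borel_measurable borel" "bounded (range f)"
  shows "(\<integral>y. f y \<partial>dual_semigroup M \<rho> t \<mu>) = (\<integral>x. (\<integral>\<omega>. f (\<rho> t x \<omega>) \<partial>M) \<partial>\<mu>)"
proof -
  interpret mu: prob_space \<mu> using mu by (simp add: space_prob_algebra)
  have s: "sets \<mu> = sets borel" using mu by (simp add: space_prob_algebra)
  obtain B where B: "\<And>x. \<bar>f x\<bar> \<le> B" using f(2) by (auto simp: bounded_iff)
  have "transition M \<rho> t \<in> \<mu> \<rightarrow>\<^sub>M subprob_algebra borel"
    using measurable_prob_algebraD[OF measurable_transition[OF nonexp t]] s measurable_cong_sets by blast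
  then have "(\<integral>y. f y \<partial>dual_semigroup M \<rho> t \<mu>) = (\<integral>x. (\<integral>y. f y \<partial>transition M \<rho> t x) \<partial>\<mu>)"
    unfolding dual_semigroup_def
    by (intro integral_bind[where K=borel and B=B and B'=1])
       (use B f(1) in \<open>auto simp: transition_def prob_space.emeasure_space_1 prob_space.prob_space_distr
          mu.not_empty measurable_rho[OF t] emeasure_space_1 emeasure_distr\<close>)
  then show ?thesis
    using f(1) measurable_rho[OF t] by (simp add: transition_def integral_distr)
qed

end

theory Submission
  imports Defs
begin

text \<open>By non-expansivity the semigroup preserves bounded Lipschitz functions together with their
  constants, so it suffices to study, for such an \<open>f\<close>, the limiting gap between \<open>P\<^sub>t f x\<close> and
  \<open>P\<^sub>t f y\<close>.  The gap only depends on the one-point laws, hence the two points may be driven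
  independently: by the support property independent copies started in a compact set come close with
  positive probability, and by the dissipation estimate they visit a common compact set
  simultaneously, so the supremum of the limiting gap is zero.  (With the given joint driving the two
  points need not come close: think of a Brownian rotation of the circle.)

  The same uniform returns to compact sets show that \<open>P\<^sub>t f x\<close> is Cauchy in \<open>t\<close>.  Its limit is a
  positive functional of \<open>f\<close> that is tight, which replaces local compactness and completeness in the
  Riesz representation theorem, and the representing measure is the invariant one.\<close>

section \<open>Bounded Lipschitz functions\<close>

text \<open>Two inputs are weaker than the argument would like. The dissipation estimate places the
  process in a compact set only on average over time, so a good time exists but depends on the
  starting points. The supremum argument needs such a time for two points at once, the Cauchy
  property needs one that is good again after a prescribed shift; \<open>common_return_times\<close>
  supplies both from one averaging argument. Likewise the support property bounds an integral over
  time, so a deterministic time that suits both points has to be extracted, which is done in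
  \<open>common_tube_time\<close>. Bounded Lipschitz functions suit the problem because one constant
  serves all times: the gap has a modulus of continuity independent of time, so its limit attains a
  maximum on compact sets and Dini's theorem turns pointwise into uniform decay. The class is still
  rich enough, since every bounded continuous function is a pointwise limit of such functions from
  below.\<close>

definition bdd_lipschitz :: "('a::metric_space \<Rightarrow> real) \<Rightarrow> bool" where
  "bdd_lipschitz f \<longleftrightarrow> (\<exists>B\<ge>0. \<forall>x y. \<bar>f x\<bar> \<le> B \<and> \<bar>f x - f y\<bar> \<le> B * dist x y)"

lemma bdd_lipschitzI:
  assumes "\<And>x. \<bar>f x\<bar> \<le> A" "\<And>x y. \<bar>f x - f y\<bar> \<le> B * dist x y"
  shows "bdd_lipschitz f"
proof -
  have "0 \<le> max 0 (max A B) \<and> (\<forall>x y. \<bar>f x\<bar> \<le> max 0 (max A B) \<and>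
      \<bar>f x - f y\<bar> \<le> max 0 (max A B) * dist x y)"
  proof (intro conjI allI)
    fix x y
    show "\<bar>f x\<bar> \<le> max 0 (max A B)" using assms(1)[of x] by linarith
    have "B * dist x y \<le> max 0 (max A B) * dist x y" by (intro mult_right_mono) auto
    then show "\<bar>f x - f y\<bar> \<le> max 0 (max A B) * dist x y" using assms(2)[of x y] by linarith
  qed simp
  then show ?thesis unfolding bdd_lipschitz_def by blast
qed

lemma bdd_lipschitzE:
  assumes "bdd_lipschitz f"
  obtains B where "0 \<le> B" "\<And>x. \<bar>f x\<bar> \<le> B" "\<And>x y. \<bar>f x - f y\<bar> \<le> B * dist x y"
  using assms unfolding bdd_lipschitz_def by blast

lemma bdd_lipschitz_continuous_on:
  assumes "bdd_lipschitz f" shows "continuous_on A f"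
proof -
  obtain B where "0 \<le> B" "\<And>x. \<bar>f x\<bar> \<le> B" "\<And>x y. \<bar>f x - f y\<bar> \<le> B * dist x y"
    using assms by (rule bdd_lipschitzE) blast
  then have "B-lipschitz_on A f" by (intro lipschitz_onI) (auto simp: dist_real_def)
  then show ?thesis by (rule lipschitz_on_continuous_on)
qed

lemma bdd_lipschitz_measurable: "bdd_lipschitz f \<Longrightarrow> f \<in> borel_measurable borel"
  by (intro borel_measurable_continuous_onI bdd_lipschitz_continuous_on)

lemma bdd_lipschitz_bounded: "bdd_lipschitz f \<Longrightarrow> bounded (range f)"
  unfolding bdd_lipschitz_def bounded_iff by auto

lemma bdd_lipschitz_const: "bdd_lipschitz (\<lambda>_. c)"
  by (rule bdd_lipschitzI[where A="\<bar>c\<bar>" and B=0]) auto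

lemma bdd_lipschitz_add:
  assumes "bdd_lipschitz f" "bdd_lipschitz g"
  shows "bdd_lipschitz (\<lambda>x. f x + g x)"
proof -
  obtain A where A: "0 \<le> A" "\<And>x. \<bar>f x\<bar> \<le> A" "\<And>x y. \<bar>f x - f y\<bar> \<le> A * dist x y"
    using assms(1) by (rule bdd_lipschitzE) blast
  obtain B where B: "0 \<le> B" "\<And>x. \<bar>g x\<bar> \<le> B" "\<And>x y. \<bar>g x - g y\<bar> \<le> B * dist x y"
    using assms(2) by (rule bdd_lipschitzE) blast
  show ?thesis
  proof (rule bdd_lipschitzI[where A="A+B" and B="A+B"])
    fix x y
    show "\<bar>f x + g x\<bar> \<le> A + B" using A(2)[of x] B(2)[of x] by linarith
    show "\<bar>f x + g x - (f y + g y)\<bar> \<le> (A + B) * dist x y"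
      using A(3)[of x y] B(3)[of x y] by (simp add: distrib_right)
  qed
qed

lemma bdd_lipschitz_cmult:
  assumes "bdd_lipschitz f" shows "bdd_lipschitz (\<lambda>x. c * f x)"
proof -
  obtain A where A: "0 \<le> A" "\<And>x. \<bar>f x\<bar> \<le> A" "\<And>x y. \<bar>f x - f y\<bar> \<le> A * dist x y"
    using assms(1) by (rule bdd_lipschitzE) blast
  show ?thesis
  proof (rule bdd_lipschitzI[where A="\<bar>c\<bar> * A" and B="\<bar>c\<bar> * A"])
    fix x y
    show "\<bar>c * f x\<bar> \<le> \<bar>c\<bar> * A" using A(2)[of x] by (simp add: abs_mult mult_left_mono)
    have "\<bar>c * f x - c * f y\<bar> = \<bar>c\<bar> * \<bar>f x - f y\<bar>" by (simp add: abs_mult flip: right_diff_distrib)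
    also have "\<dots> \<le> \<bar>c\<bar> * (A * dist x y)" by (intro mult_left_mono A) auto
    finally show "\<bar>c * f x - c * f y\<bar> \<le> \<bar>c\<bar> * A * dist x y" by (simp add: mult.assoc)
  qed
qed

lemma bdd_lipschitz_diff:
  assumes "bdd_lipschitz f" "bdd_lipschitz g"
  shows "bdd_lipschitz (\<lambda>x. f x - g x)"
  using bdd_lipschitz_add[OF assms(1) bdd_lipschitz_cmult[OF assms(2), of "-1"]] by simp

lemma bdd_lipschitz_max:
  assumes "bdd_lipschitz f" "bdd_lipschitz g"
  shows "bdd_lipschitz (\<lambda>x. max (f x) (g x))"
proof -
  obtain A where A: "0 \<le> A" "\<And>x. \<bar>f x\<bar> \<le> A" "\<And>x y. \<bar>f x - f y\<bar> \<le> A * dist x y"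
    using assms(1) by (rule bdd_lipschitzE) blast
  obtain B where B: "0 \<le> B" "\<And>x. \<bar>g x\<bar> \<le> B" "\<And>x y. \<bar>g x - g y\<bar> \<le> B * dist x y"
    using assms(2) by (rule bdd_lipschitzE) blast
  show ?thesis
  proof (rule bdd_lipschitzI[where A="A+B" and B="A+B"])
    fix x y
    show "\<bar>max (f x) (g x)\<bar> \<le> A + B" using A(1) B(1) A(2)[of x] B(2)[of x] by linarith
    have "0 \<le> A * dist x y" "0 \<le> B * dist x y" using A(1) B(1) by auto
    then show "\<bar>max (f x) (g x) - max (f y) (g y)\<bar> \<le> (A + B) * dist x y"
      using A(3)[of x y] B(3)[of x y] unfolding distrib_right by linarith
  qed
qed

lemma bdd_lipschitz_min:
  assumes "bdd_lipschitz f" "bdd_lipschitz g"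
  shows "bdd_lipschitz (\<lambda>x. min (f x) (g x))"
proof -
  have "bdd_lipschitz (\<lambda>x. -1 * max (-1 * f x) (-1 * g x))"
    by (intro bdd_lipschitz_cmult bdd_lipschitz_max assms)
  moreover have "-1 * max (-1 * f x) (-1 * g x) = min (f x) (g x)" for x
    by (auto simp: min_def max_def)
  ultimately show ?thesis by simp
qed

lemma bdd_lipschitz_sum:
  assumes "\<And>i. i \<in> I \<Longrightarrow> bdd_lipschitz (f i)"
  shows "bdd_lipschitz (\<lambda>x. \<Sum>i\<in>I. f i x)"
  using assms
  by (induction I rule: infinite_finite_induct) (auto intro: bdd_lipschitz_const bdd_lipschitz_add)

text \<open>The case distinction is needed because the distance to the empty set is \<open>0\<close>.\<close>

definition inner_approx :: "'a::metric_space set \<Rightarrow> nat \<Rightarrow> 'a \<Rightarrow> real" where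
  "inner_approx U n x = (if U = UNIV then 1 else min 1 (real n * infdist x (- U)))"

lemma bdd_lipschitz_inner_approx: "bdd_lipschitz (inner_approx U n)"
proof (rule bdd_lipschitzI[where A=1 and B="real n"])
  fix x y
  have "0 \<le> real n * infdist x (-U)" by (simp add: infdist_nonneg)
  then show "\<bar>inner_approx U n x\<bar> \<le> 1" unfolding inner_approx_def by auto
  have "\<bar>real n * infdist x (-U) - real n * infdist y (-U)\<bar> \<le> real n * dist x y"
    using infdist_triangle_abs[of x "-U" y]
    by (simp add: abs_mult mult_left_mono flip: right_diff_distrib)
  moreover have "0 \<le> real n * dist x y" by simp
  ultimately show "\<bar>inner_approx U n x - inner_approx U n y\<bar> \<le> real n * dist x y"
    unfolding inner_approx_def by (simp only: split: if_split) linarith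
qed

lemma inner_approx_bounds: "0 \<le> inner_approx U n x" "inner_approx U n x \<le> 1"
  by (auto simp: inner_approx_def infdist_nonneg)

lemma inner_approx_outside: "x \<notin> U \<Longrightarrow> inner_approx U n x = 0"
  by (auto simp: inner_approx_def)

lemma inner_approx_mono: "m \<le> n \<Longrightarrow> inner_approx U m x \<le> inner_approx U n x"
  unfolding inner_approx_def by (simp add: infdist_nonneg mult_right_mono min.coboundedI2)

lemma inner_approx_eventually:
  assumes "open U" "x \<in> U"
  shows "\<exists>N. \<forall>n\<ge>N. inner_approx U n x = 1"
proof (cases "U = UNIV")
  case False
  have "infdist x (-U) > 0"
    using assms False by (intro infdist_pos_not_in_closed) auto
  then obtain N where N: "1 < real N * infdist x (-U)"
    using reals_Archimedean3 by blast
  have "inner_approx U n x = 1" if "n \<ge> N" for n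
  proof -
    have "real N * infdist x (-U) \<le> real n * infdist x (-U)"
      using that by (intro mult_right_mono infdist_nonneg) auto
    then show ?thesis using N False by (simp add: inner_approx_def)
  qed
  then show ?thesis by blast
qed (simp add: inner_approx_def)

lemma inner_approx_tendsto:
  assumes "open U"
  shows "(\<lambda>n. inner_approx U n x) \<longlonglongrightarrow> indicator U x"
proof (cases "x \<in> U")
  case True
  then obtain N where "\<forall>n\<ge>N. inner_approx U n x = 1" using inner_approx_eventually[OF assms] by blast
  then have "eventually (\<lambda>n. inner_approx U n x = 1) sequentially"
    by (auto simp: eventually_sequentially)
  then show ?thesis using True by (simp add: tendsto_eventually)
qed (simp add: inner_approx_outside)

text \<open>Pointwise convergence makes the open sets where \<open>h n < e\<close> cover
  \<open>K\<close>, and monotonicity makes them grow with \<open>n\<close>, so by compactness a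
  single one contains \<open>K\<close>.\<close>

lemma dini_compact:
  fixes h :: "nat \<Rightarrow> 'a::topological_space \<Rightarrow> real"
  assumes K: "compact K"
    and cont: "\<And>n. continuous_on UNIV (h n)"
    and dec: "\<And>m n x. m \<le> n \<Longrightarrow> h n x \<le> h m x"
    and lim: "\<And>x. x \<in> K \<Longrightarrow> (\<lambda>n. h n x) \<longlonglongrightarrow> 0"
    and e: "0 < e"
  shows "\<exists>N. \<forall>n\<ge>N. \<forall>x\<in>K. h n x < e"
proof -
  have opn: "open {x. h n x < e}" for n
    by (intro open_Collect_less cont continuous_on_const)
  have cov: "K \<subseteq> (\<Union>n\<in>UNIV. {x. h n x < e})"
  proof
    fix x assume "x \<in> K"
    from order_tendstoD(2)[OF lim[OF this] e] show "x \<in> (\<Union>n\<in>UNIV. {x. h n x < e})"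
      by (auto simp: eventually_sequentially)
  qed
  obtain C' where C': "finite C'" "K \<subseteq> (\<Union>n\<in>C'. {x. h n x < e})"
    by (rule compactE_image[OF K opn cov])
  \<comment> \<open>The inserted \<open>0\<close> keeps \<open>Max\<close> meaningful when
    \<open>K\<close> is empty and the subcover may be empty too.\<close>
  have "h n x < e" if n: "n \<ge> Max (insert 0 C')" and x: "x \<in> K" for n x
  proof -
    obtain m where m: "m \<in> C'" "h m x < e" using C' x by blast
    then have "m \<le> n" using n C'(1) by (auto intro: order_trans[OF Max_ge])
    from dec[OF this, of x] m(2) show ?thesis by linarith
  qed
  then show ?thesis by blast
qed

section \<open>A Riesz representation theorem without local compactness\<close>

text \<open>No measure exists yet, so tightness is phrased through test functions: for integration
  against a probability measure, \<open>tight\<close> says that the complement of \<open>K\<close>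
  has mass at most \<open>e\<close>.\<close>

locale tight_functional =
  fixes L :: "('a::metric_space \<Rightarrow> real) \<Rightarrow> real"
  assumes add: "\<And>f g. bdd_lipschitz f \<Longrightarrow> bdd_lipschitz g \<Longrightarrow> L (\<lambda>x. f x + g x) = L f + L g"
    and cmult: "\<And>c f. bdd_lipschitz f \<Longrightarrow> L (\<lambda>x. c * f x) = c * L f"
    and nonneg: "\<And>f. bdd_lipschitz f \<Longrightarrow> (\<And>x. 0 \<le> f x) \<Longrightarrow> 0 \<le> L f"
    and one: "L (\<lambda>_. 1) = 1"
    and tight: "\<And>e. 0 < e \<Longrightarrow> \<exists>K. compact K \<and>
      (\<forall>f. bdd_lipschitz f \<longrightarrow> (\<forall>x. 0 \<le> f x \<and> f x \<le> 1) \<longrightarrow> (\<forall>x\<in>K. f x = 0) \<longrightarrow> L f \<le> e)"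
begin

lemma const: "L (\<lambda>_. c) = c"
  using cmult[OF bdd_lipschitz_const, of c 1] one by simp

lemma diff: "bdd_lipschitz f \<Longrightarrow> bdd_lipschitz g \<Longrightarrow> L (\<lambda>x. f x - g x) = L f - L g"
  using add[of f "\<lambda>x. -1 * g x"] cmult[of g "-1"] bdd_lipschitz_cmult[of g "-1"] by simp

lemma mono:
  assumes "bdd_lipschitz f" "bdd_lipschitz g" "\<And>x. f x \<le> g x"
  shows "L f \<le> L g"
  using nonneg[OF bdd_lipschitz_diff[OF assms(2,1)]] diff[OF assms(2,1)] assms(3) by simp

lemma sum:
  assumes "\<And>i. i \<in> I \<Longrightarrow> bdd_lipschitz (f i)"
  shows "L (\<lambda>x. \<Sum>i\<in>I. f i x) = (\<Sum>i\<in>I. L (f i))"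
  using assms
  by (induction I rule: infinite_finite_induct) (auto simp: const add bdd_lipschitz_sum)

text \<open>Daniell's condition, obtained from tightness. By Dini \<open>h n\<close> is below
  \<open>e\<close> on \<open>K\<close>, so its excess over the level \<open>e\<close> vanishes on
  \<open>K\<close> and costs at most \<open>e\<close>; the part below the level costs another
  \<open>e\<close>.\<close>

lemma daniell_continuity:
  assumes h: "\<And>n. bdd_lipschitz (h n)" "\<And>n x. 0 \<le> h n x" "\<And>n x. h n x \<le> 1"
    and dec: "\<And>m n x. m \<le> n \<Longrightarrow> h n x \<le> h m x"
    and lim: "\<And>x. (\<lambda>n. h n x) \<longlonglongrightarrow> 0"
    and e: "0 < e"
  shows "\<exists>N. \<forall>n\<ge>N. L (h n) \<le> 2 * e"
proof -
  obtain K where K: "compact K" and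
    KL: "\<And>f. bdd_lipschitz f \<Longrightarrow> (\<And>x. 0 \<le> f x \<and> f x \<le> 1) \<Longrightarrow> (\<And>x. x \<in> K \<Longrightarrow> f x = 0) \<Longrightarrow> L f \<le> e"
    using tight[OF e] by metis
  obtain N where N: "\<forall>n\<ge>N. \<forall>x\<in>K. h n x < e"
    using dini_compact[OF K bdd_lipschitz_continuous_on[OF h(1)] dec lim e] by blast
  have "L (h n) \<le> 2 * e" if n: "n \<ge> N" for n
  proof -
    have small: "h n x \<le> e" if "x \<in> K" for x
      using N n that by (simp add: less_imp_le)
    have bl: "bdd_lipschitz (\<lambda>x. max 0 (h n x - e))"
      by (intro bdd_lipschitz_max bdd_lipschitz_diff bdd_lipschitz_const h)
    have "L (\<lambda>x. max 0 (h n x - e)) \<le> e"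
    proof (rule KL[OF bl])
      show "0 \<le> max 0 (h n x - e) \<and> max 0 (h n x - e) \<le> 1" for x
        using h(3)[of n x] e by auto
      show "max 0 (h n x - e) = 0" if "x \<in> K" for x
        using small[OF that] by simp
    qed
    moreover have "L (h n) \<le> L (\<lambda>x. max 0 (h n x - e) + e)"
      by (intro mono bdd_lipschitz_add bl h bdd_lipschitz_const) auto
    ultimately show ?thesis by (simp add: add[OF bl bdd_lipschitz_const] const)
  qed
  then show ?thesis by blast
qed

section \<open>Content of open sets and the induced outer measure\<close>

definition below :: "'a set \<Rightarrow> ('a \<Rightarrow> real) set" where
  "below U = {f. bdd_lipschitz f \<and> (\<forall>x. 0 \<le> f x \<and> f x \<le> 1) \<and> (\<forall>x. x \<notin> U \<longrightarrow> f x = 0)}"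

text \<open>In the locally compact theory the test functions have compact support inside
  \<open>U\<close>. Without local compactness only the zero function may have that property, so
  \<open>below U\<close> asks just for vanishing outside \<open>U\<close>, and tightness takes over
  the role of compact supports.\<close>

definition content :: "'a set \<Rightarrow> ennreal" where
  "content U = (SUP f\<in>below U. ennreal (L f))"

definition outer :: "'a set \<Rightarrow> ennreal" where
  "outer A = (INF U\<in>{U. open U \<and> A \<subseteq> U}. content U)"

lemma content_mono: "U \<subseteq> V \<Longrightarrow> content U \<le> content V"
  unfolding content_def below_def by (intro SUP_subset_mono) auto

lemma content_le_1: "content U \<le> 1"
  unfolding content_def
proof (rule SUP_least)
  fix f assume "f \<in> below U"
  then have "L f \<le> L (\<lambda>_. 1)" by (intro mono) (auto simp: below_def bdd_lipschitz_const)
  then show "ennreal (L f) \<le> 1" by (simp add: one)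
qed

lemma content_UNIV: "content UNIV = 1"
proof (rule antisym[OF content_le_1])
  have "(\<lambda>_. 1) \<in> below UNIV" by (auto simp: below_def bdd_lipschitz_const)
  then have "ennreal (L (\<lambda>_. 1)) \<le> content UNIV" unfolding content_def by (rule SUP_upper)
  then show "1 \<le> content UNIV" by (simp add: one)
qed

lemma outer_mono: "A \<subseteq> B \<Longrightarrow> outer A \<le> outer B"
  unfolding outer_def by (intro INF_superset_mono) auto

lemma outer_open: "open U \<Longrightarrow> outer U = content U"
  unfolding outer_def
  by (intro antisym INF_lower INF_greatest) (auto intro: content_mono)

text \<open>A compact support of \<open>f\<close> would be covered by finitely many
  \<open>U i\<close>. Instead, the part \<open>h n\<close> of \<open>f\<close> left uncovered by the
  first \<open>n\<close> sets decreases to \<open>0\<close>, and \<open>daniell_continuity\<close>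
  makes its contribution negligible.\<close>

lemma content_Union:
  fixes U :: "nat \<Rightarrow> 'a set"
  assumes U: "\<And>i. open (U i)"
  shows "content (\<Union>i. U i) \<le> (\<Sum>i. content (U i))"
  unfolding content_def[of "\<Union>i. U i"]
proof (rule SUP_least)
  fix f assume f: "f \<in> below (\<Union>i. U i)"
  then have f_bl: "bdd_lipschitz f" and f_bd: "\<And>x. 0 \<le> f x" "\<And>x. f x \<le> 1"
    and f_out: "\<And>x. x \<notin> (\<Union>i. U i) \<Longrightarrow> f x = 0"
    by (auto simp: below_def)
  \<comment> \<open>The index \<open>n\<close> counts the sets used and also sharpens each
    approximation. Both effects make \<open>s\<close> increase with \<open>n\<close>, so
    \<open>h\<close> decreases.\<close>
  define s where "s n x = (\<Sum>i<n. inner_approx (U i) n x)" for n x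
  define h where "h n x = f x - min (f x) (s n x)" for n x
  have s_bl: "bdd_lipschitz (s n)" for n
    unfolding s_def by (intro bdd_lipschitz_sum bdd_lipschitz_inner_approx)
  have s_nonneg: "0 \<le> s n x" for n x
    unfolding s_def by (intro sum_nonneg inner_approx_bounds)
  have h_bl: "bdd_lipschitz (h n)" for n
    unfolding h_def by (intro bdd_lipschitz_diff bdd_lipschitz_min f_bl s_bl)
  have s_mono: "s m x \<le> s n x" if "m \<le> n" for m n x
  proof -
    have "s m x \<le> (\<Sum>i<m. inner_approx (U i) n x)"
      unfolding s_def using that by (intro sum_mono inner_approx_mono)
    also have "\<dots> \<le> s n x"
      unfolding s_def using that by (intro sum_mono2) (auto intro: inner_approx_bounds)
    finally show ?thesis .
  qed
  have h_lim: "(\<lambda>n. h n x) \<longlonglongrightarrow> 0" for x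
  proof (cases "x \<in> (\<Union>i. U i)")
    case True
    then obtain i where i: "x \<in> U i" by blast
    obtain N where N: "\<forall>n\<ge>N. inner_approx (U i) n x = 1"
      using inner_approx_eventually[OF U i] by blast
    have "h n x = 0" if "n \<ge> max N (Suc i)" for n
    proof -
      have "1 \<le> s n x"
        using member_le_sum[of i "{..<n}" "\<lambda>i. inner_approx (U i) n x"] N that
        by (auto simp: s_def inner_approx_bounds)
      then show ?thesis using f_bd(2)[of x] by (simp add: h_def)
    qed
    then show ?thesis
      by (intro tendsto_eventually eventually_sequentiallyI)
  next
    case False
    then show ?thesis using s_nonneg[of _ x] by (simp add: h_def f_out min_def)
  qed
  show "ennreal (L f) \<le> (\<Sum>i. content (U i))"
  proof (rule ennreal_le_epsilon)
    fix e :: real assume e: "0 < e"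
    obtain n where n: "L (h n) \<le> 2 * (e/2)"
    proof -
      have "\<exists>N. \<forall>n\<ge>N. L (h n) \<le> 2 * (e/2)"
      proof (rule daniell_continuity)
        show "h n x \<le> h m x" if "m \<le> n" for m n x using s_mono[OF that, of x] by (auto simp: h_def)
        show "h n x \<le> 1" for n x
          using f_bd(2)[of x] f_bd(1)[of x] s_nonneg[of n x] by (auto simp: h_def)
      qed (use e in \<open>auto simp: h_bl h_lim, auto simp: h_def\<close>)
      then show ?thesis using that by blast
    qed
    have "L f \<le> L (\<lambda>x. h n x + s n x)"
      by (intro mono f_bl bdd_lipschitz_add h_bl s_bl) (auto simp: h_def)
    also have "\<dots> = L (h n) + (\<Sum>i<n. L (inner_approx (U i) n))"
      by (subst add[OF h_bl s_bl], unfold s_def, subst sum) (auto intro: bdd_lipschitz_inner_approx)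
    finally have "ennreal (L f) \<le> ennreal ((\<Sum>i<n. L (inner_approx (U i) n)) + e)"
      using n by (intro ennreal_leI) linarith
    also have "\<dots> = (\<Sum>i<n. ennreal (L (inner_approx (U i) n))) + ennreal e"
      using e by (subst ennreal_plus)
        (auto intro!: sum_nonneg nonneg bdd_lipschitz_inner_approx inner_approx_bounds sum_ennreal[symmetric])
    also have "(\<Sum>i<n. ennreal (L (inner_approx (U i) n))) \<le> (\<Sum>i<n. content (U i))"
    proof (rule sum_mono)
      fix i
      have "inner_approx (U i) n \<in> below (U i)"
        by (auto simp: below_def bdd_lipschitz_inner_approx inner_approx_bounds inner_approx_outside)
      then show "ennreal (L (inner_approx (U i) n)) \<le> content (U i)"
        unfolding content_def by (rule SUP_upper)
    qed
    also have "\<dots> \<le> (\<Sum>i. content (U i))"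
      by (intro sum_le_suminf) auto
    finally show "ennreal (L f) \<le> (\<Sum>i. content (U i)) + ennreal e"
      by (simp add: add_right_mono)
  qed
qed

lemma outer_subadditive:
  fixes A :: "nat \<Rightarrow> 'a set"
  shows "outer (\<Union>i. A i) \<le> (\<Sum>i. outer (A i))"
proof (rule ennreal_le_epsilon)
  fix e :: real assume e: "0 < e" and fin: "(\<Sum>i. outer (A i)) < top"
  have "\<exists>U. open U \<and> A i \<subseteq> U \<and> content U \<le> outer (A i) + ennreal (e * (1/2)^Suc i)" for i
  proof -
    have "outer (A i) \<le> content UNIV" unfolding outer_def by (intro INF_lower) auto
    also have "\<dots> < top" by (simp add: content_UNIV)
    finally have "outer (A i) \<noteq> \<infinity>" by simp
    moreover have "0 < ennreal (e * (1/2)^Suc i)" using e by (subst ennreal_less_zero_iff) simp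
    ultimately have "outer (A i) + 0 < outer (A i) + ennreal (e * (1/2)^Suc i)"
      by (subst ennreal_add_left_cancel_less) (rule conjI)
    then have "outer (A i) < outer (A i) + ennreal (e * (1/2)^Suc i)" by (subst (asm) add_0_right)
    then show ?thesis
      unfolding outer_def[of "A i"] INF_less_iff by (auto intro: less_imp_le)
  qed
  then obtain U where U: "\<And>i. open (U i)" "\<And>i. A i \<subseteq> U i"
    "\<And>i. content (U i) \<le> outer (A i) + ennreal (e * (1/2)^Suc i)"
    by metis
  have "outer (\<Union>i. A i) \<le> content (\<Union>i. U i)"
    unfolding outer_def using U by (intro INF_lower) blast
  also have "\<dots> \<le> (\<Sum>i. content (U i))" by (intro content_Union U)
  also have "\<dots> \<le> (\<Sum>i. outer (A i) + ennreal (e * (1/2)^Suc i))"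
    by (intro suminf_le U) auto
  also have "\<dots> = (\<Sum>i. outer (A i)) + (\<Sum>i. ennreal (e * (1/2)^Suc i))"
    by (intro suminf_add[symmetric]) auto
  also have "(\<Sum>i. ennreal (e * (1/2)^Suc i)) = ennreal e"
    using sums_mult[OF power_half_series, of e] e
    by (intro suminf_ennreal_eq) auto
  finally show "outer (\<Union>i. A i) \<le> (\<Sum>i. outer (A i)) + ennreal e" .
qed

lemma outer_empty: "outer {} = 0"
proof -
  have "L f = 0" if "f \<in> below {}" for f
  proof -
    have "f = (\<lambda>_. 0)" using that by (auto simp: below_def)
    then show ?thesis by (simp add: const)
  qed
  then have "content {} \<le> 0"
    unfolding content_def by (intro SUP_least) simp
  then have "content {} = 0" by simp
  then show ?thesis by (simp add: outer_open)
qed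

lemma outer_measure: "outer_measure_space (Pow UNIV) outer"
  unfolding outer_measure_space_def positive_def increasing_def countably_subadditive_def
  by (auto simp: outer_empty intro: outer_mono outer_subadditive)

text \<open>Truncating \<open>f\<close> at a positive level makes its support closed, so that it can be added to any
  function below the open complement of that support.\<close>

lemma content_split:
  assumes U: "open U" and V: "open V"
  shows "content (V \<inter> U) + outer (V - U) \<le> content V"
proof -
  have "content (V \<inter> U) \<le> content V - outer (V - U)"
    unfolding content_def[of "V \<inter> U"]
  proof (rule SUP_least)
    fix f assume f: "f \<in> below (V \<inter> U)"
    then have f_bl: "bdd_lipschitz f" and f_bd: "\<And>x. 0 \<le> f x" "\<And>x. f x \<le> 1"
      and f_out: "\<And>x. x \<notin> V \<inter> U \<Longrightarrow> f x = 0"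
      by (auto simp: below_def)
    have fin: "outer (V - U) \<noteq> top"
    proof -
      have "outer (V - U) \<le> content UNIV" unfolding outer_def by (intro INF_lower) auto
      also have "\<dots> < top" by (simp add: content_UNIV)
      finally show ?thesis by simp
    qed
    have "ennreal (L f) + outer (V - U) \<le> content V"
    proof (rule ennreal_le_epsilon)
      fix e :: real assume e: "0 < e"
      define f' where "f' x = max 0 (f x - e)" for x
      have f'_bl: "bdd_lipschitz f'"
        unfolding f'_def by (intro bdd_lipschitz_max bdd_lipschitz_diff bdd_lipschitz_const f_bl)
      define W where "W = V - {x. e \<le> f x}"
      have "closed {x. e \<le> f x}"
        by (intro closed_Collect_le bdd_lipschitz_continuous_on f_bl continuous_on_const)
      then have W: "open W" unfolding W_def using V by blast
      have "V - U \<subseteq> W" using e by (auto simp: W_def f_out)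
      then have "outer (V - U) \<le> content W"
        unfolding outer_def using W by (intro INF_lower) blast
      also have "\<dots> \<le> content V - ennreal (L f')"
        unfolding content_def[of W]
      proof (rule SUP_least)
        fix h assume "h \<in> below W"
        then have h_bl: "bdd_lipschitz h" and h_bd: "\<And>x. 0 \<le> h x" "\<And>x. h x \<le> 1"
          and h_out: "\<And>x. x \<notin> W \<Longrightarrow> h x = 0"
          by (auto simp: below_def)
        have "(\<lambda>x. f' x + h x) \<in> below V"
          unfolding below_def
        proof (intro CollectI conjI allI impI bdd_lipschitz_add f'_bl h_bl)
          fix x
          show "0 \<le> f' x + h x" using h_bd by (simp add: f'_def)
          show "f' x + h x \<le> 1"
            using h_bd[of x] h_out[of x] f_bd[of x] e by (cases "x \<in> W") (auto simp: f'_def W_def)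
          show "f' x + h x = 0" if "x \<notin> V"
            using that h_out[of x] f_out[of x] e by (auto simp: f'_def W_def)
        qed
        then have "ennreal (L (\<lambda>x. f' x + h x)) \<le> content V"
          unfolding content_def by (rule SUP_upper)
        also have "L (\<lambda>x. f' x + h x) = L f' + L h" by (rule add[OF f'_bl h_bl])
        also have "ennreal (L f' + L h) = ennreal (L f') + ennreal (L h)"
          using h_bd by (intro ennreal_plus nonneg f'_bl h_bl) (auto simp: f'_def)
        finally show "ennreal (L h) \<le> content V - ennreal (L f')"
          by (simp add: ennreal_le_minus_iff add.commute)
      qed
      finally have 1: "outer (V - U) \<le> content V - ennreal (L f')" .
      have "f' x \<le> 1" for x using f_bd(2)[of x] e by (simp add: f'_def)
      then have "f' \<in> below V" using f'_bl e f_out by (auto simp: below_def f'_def)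
      then have 2: "ennreal (L f') \<le> content V" unfolding content_def by (rule SUP_upper)
      have "L f \<le> L (\<lambda>x. f' x + e)"
        by (intro mono f_bl f'_bl bdd_lipschitz_add bdd_lipschitz_const) (auto simp: f'_def)
      also have "\<dots> = L f' + e" by (simp add: add[OF f'_bl bdd_lipschitz_const] const)
      finally have "ennreal (L f) \<le> ennreal (L f' + e)" by (rule ennreal_leI)
      also have "\<dots> = ennreal (L f') + ennreal e"
        using e by (intro ennreal_plus nonneg f'_bl) (auto simp: f'_def)
      finally have "ennreal (L f) + outer (V - U)
          \<le> ennreal (L f') + ennreal e + (content V - ennreal (L f'))"
        using 1 by (rule add_mono)
      also have "\<dots> = content V + ennreal e"
        using 2 by (metis add.assoc add.commute add_diff_inverse_ennreal)
      finally show "ennreal (L f) + outer (V - U) \<le> content V + ennreal e" .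
    qed
    then show "ennreal (L f) \<le> content V - outer (V - U)"
      using fin by (subst ennreal_le_minus_iff) (auto simp: add.commute)
  qed
  then have "content (V \<inter> U) + outer (V - U) \<le> content V - outer (V - U) + outer (V - U)"
    by (rule add_right_mono)
  also have "\<dots> = content V"
    using outer_mono[of "V - U" V] outer_open[OF V] by (intro diff_add_cancel_ennreal) simp
  finally show ?thesis .
qed

text \<open>An arbitrary \<open>A\<close> is enlarged to an open set, for which
  \<open>content_split\<close> applies, and the infimum over these sets is taken. The reverse
  inequality is countable subadditivity for the two pieces padded with empty sets.\<close>

lemma open_in_lambda_system:
  assumes U: "open U"
  shows "U \<in> lambda_system UNIV (Pow UNIV) outer"
proof -
  have "outer (A \<inter> U) + outer (A - U) = outer A" for A
  proof (rule antisym)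
    show "outer (A \<inter> U) + outer (A - U) \<le> outer A"
      unfolding outer_def[of A]
    proof (rule INF_greatest)
      fix V assume "V \<in> {V. open V \<and> A \<subseteq> V}"
      then have V: "open V" "A \<subseteq> V" by auto
      have "outer (A \<inter> U) + outer (A - U) \<le> outer (V \<inter> U) + outer (V - U)"
        using V by (intro add_mono outer_mono) auto
      also have "\<dots> \<le> content V"
        using content_split[OF U V(1)] U V by (simp add: outer_open open_Int)
      finally show "outer (A \<inter> U) + outer (A - U) \<le> content V" .
    qed
    define B where "B i = (if i = 0 then A \<inter> U else if i = 1 then A - U else {})" for i :: nat
    have "A \<subseteq> (\<Union>i. B i)" by (force simp: B_def)
    then have "outer A \<le> outer (\<Union>i. B i)" by (rule outer_mono)
    also have "\<dots> \<le> (\<Sum>i. outer (B i))" by (rule outer_subadditive)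
    also have "\<dots> = (\<Sum>i\<in>{0,1}. outer (B i))"
      by (intro suminf_finite) (auto simp: B_def outer_empty)
    finally show "outer A \<le> outer (A \<inter> U) + outer (A - U)" by (simp add: B_def)
  qed
  then show ?thesis
    unfolding lambda_system_def by (simp add: Int_commute Diff_eq)
qed

section \<open>The representing measure\<close>

definition riesz_measure :: "'a measure" where
  "riesz_measure = measure_of UNIV (sets borel) outer"

lemma sets_riesz_measure [simp]: "sets riesz_measure = sets borel"
  and space_riesz_measure [simp]: "space riesz_measure = UNIV"
  using sets.sigma_sets_eq[of borel] by (auto simp: riesz_measure_def)

lemma emeasure_riesz_measure: "A \<in> sets borel \<Longrightarrow> emeasure riesz_measure A = outer A"
proof -
  let ?S = "lambda_system UNIV (Pow UNIV) outer"
  have ms: "measure_space UNIV ?S outer"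
    using sigma_algebra.caratheodory_lemma[OF sigma_algebra_Pow outer_measure] .
  then interpret sigma_algebra UNIV ?S by (simp add: measure_space_def)
  have "sigma_sets UNIV {S. open S} \<subseteq> ?S"
    by (rule sigma_sets_subset) (use open_in_lambda_system in blast)
  then have sub: "sets borel \<subseteq> ?S"
    by (simp add: borel_def)
  have "countably_additive (sets borel) outer"
    unfolding countably_additive_def
  proof (intro allI impI)
    fix A :: "nat \<Rightarrow> 'a set"
    assume A: "range A \<subseteq> sets borel" "disjoint_family A" "(\<Union>i. A i) \<in> sets borel"
    from ms have "countably_additive ?S outer" by (simp add: measure_space_def)
    then show "(\<Sum>i. outer (A i)) = outer (\<Union>i. A i)"
      unfolding countably_additive_def using A sub by blast
  qed
  then have "measure_space UNIV (sets borel) outer"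
    using sets.sigma_algebra_axioms[of "borel :: 'a measure"]
    by (simp add: measure_space_def positive_def outer_empty)
  then show "emeasure riesz_measure A = outer A" if "A \<in> sets borel"
    using that unfolding riesz_measure_def by (intro emeasure_measure_of_sigma)
      (auto simp: measure_space_def)
qed

lemma prob_space_riesz_measure: "prob_space riesz_measure"
  by (rule prob_spaceI) (simp add: emeasure_riesz_measure outer_open content_UNIV)

text \<open>Layer-cake decomposition of \<open>f\<close> into \<open>n\<close> slices of height \<open>1 / n\<close>.\<close>

lemma functional_le_integral:
  assumes f: "bdd_lipschitz f" "\<And>x. 0 \<le> f x" "\<And>x. f x \<le> 1"
  shows "L f \<le> (\<integral>x. f x \<partial>riesz_measure)"
proof -
  interpret R: prob_space riesz_measure by (rule prob_space_riesz_measure)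
  have f_meas: "f \<in> borel_measurable riesz_measure"
    using bdd_lipschitz_measurable[OF f(1)] by (simp cong: measurable_cong_sets)
  have f_int: "integrable riesz_measure f"
    using f by (intro R.integrable_const_bound[where B=1] f_meas) auto
  have *: "L f \<le> (\<integral>x. f x \<partial>riesz_measure) + 1 / real n" if n: "n > 0" for n :: nat
  proof -
    define s where "s j x = min 1 (max 0 (real n * f x - real j))" for j x
    define A where "A j = {x. real j < real n * f x}" for j
    have s_bl: "bdd_lipschitz (s j)" for j
      unfolding s_def
      by (intro bdd_lipschitz_min bdd_lipschitz_max bdd_lipschitz_diff bdd_lipschitz_cmult
          bdd_lipschitz_const f)
    have A_open: "open (A j)" for j
      unfolding A_def
      by (intro open_Collect_less bdd_lipschitz_continuous_on bdd_lipschitz_cmult f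
          continuous_on_const)
    then have A_sets: "A j \<in> sets riesz_measure" for j by simp
    have s_sum: "(\<Sum>j<m. s j x) = min (real m) (real n * f x)" for m x
    proof (induction m)
      case 0 then show ?case using f(2)[of x] by simp
    next
      case (Suc m) then show ?case by (simp add: s_def)
    qed
    have f_eq: "f x = (1 / real n) * (\<Sum>j<n. s j x)" for x
      using s_sum[of x n] f(3)[of x] n by (simp add: min_absorb2)
    have "L f = L (\<lambda>x. (1 / real n) * (\<Sum>j<n. s j x))" using f_eq by presburger
    also have "\<dots> = (1 / real n) * (\<Sum>j<n. L (s j))"
      by (subst cmult) (auto intro: bdd_lipschitz_sum s_bl simp: sum s_bl)
    also have "\<dots> \<le> (1 / real n) * (\<Sum>j<n. measure riesz_measure (A j))"
    proof (intro mult_left_mono sum_mono)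
      fix j
      have "s j \<in> below (A j)" using s_bl by (auto simp: below_def s_def A_def)
      then have "ennreal (L (s j)) \<le> content (A j)" unfolding content_def by (rule SUP_upper)
      also have "\<dots> = emeasure riesz_measure (A j)"
        using A_open by (simp add: emeasure_riesz_measure outer_open)
      finally show "L (s j) \<le> measure riesz_measure (A j)"
        by (simp add: R.emeasure_eq_measure)
    qed simp
    also have "\<dots> = (\<integral>x. (1 / real n) * (\<Sum>j<n. indicator (A j) x) \<partial>riesz_measure)"
      using A_sets by (simp add: Bochner_Integration.integral_sum R.emeasure_eq_measure)
    also have "\<dots> \<le> (\<integral>x. f x + 1 / real n \<partial>riesz_measure)"
    proof (rule integral_mono)
      show "integrable riesz_measure (\<lambda>x. (1 / real n) * (\<Sum>j<n. indicator (A j) x))"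
        using A_sets by (auto simp: R.emeasure_eq_measure)
      show "integrable riesz_measure (\<lambda>x. f x + 1 / real n)" using f_int by auto
      fix x
      \<comment> \<open>The bound by \<open>real m\<close> feeds the induction: if \<open>x\<close>
        lies in \<open>A m\<close>, the first \<open>m\<close> terms sum to at most
        \<open>m\<close>, which is less than \<open>real n * f x\<close>, so one more term is
        affordable.\<close>
      have "(\<Sum>j<m. indicator (A j) x) \<le> real n * f x + 1 \<and>
          (\<Sum>j<m. indicator (A j) x) \<le> real m" for m
      proof (induction m)
        case 0 then show ?case using f(2)[of x] by simp
      next
        case (Suc m)
        then show ?case by (auto simp: A_def indicator_def)
      qed
      then have "(\<Sum>j<n. indicator (A j) x) \<le> real n * f x + 1" by blast
      then have "(1 / real n) * (\<Sum>j<n. indicator (A j) x) \<le> (1 / real n) * (real n * f x + 1)"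
        by (intro mult_left_mono) auto
      then show "(1 / real n) * (\<Sum>j<n. indicator (A j) x) \<le> f x + 1 / real n"
        using n by (simp add: field_simps)
    qed
    also have "\<dots> = (\<integral>x. f x \<partial>riesz_measure) + 1 / real n"
      using f_int R.prob_space by simp
    finally show ?thesis .
  qed
  have "(\<lambda>n. (\<integral>x. f x \<partial>riesz_measure) + 1 / real n) \<longlonglongrightarrow> (\<integral>x. f x \<partial>riesz_measure) + 0"
    by (intro tendsto_intros lim_1_over_n)
  then show ?thesis
    using * by (intro LIMSEQ_le_const[of _ "(\<integral>x. f x \<partial>riesz_measure)" "L f"]) (auto intro!: exI[of _ 1])
qed

text \<open>Since \<open>content\<close> is a supremum, \<open>functional_le_integral\<close> is
  one-sided. Applying it to \<open>g\<close> and to \<open>1 - g\<close> forces equality, because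
  \<open>L\<close> and the integral agree on constants; \<open>g\<close> is an affine image of
  \<open>f\<close> with values in [0, 1].\<close>

theorem riesz_representation:
  assumes f: "bdd_lipschitz f"
  shows "(\<integral>x. f x \<partial>riesz_measure) = L f"
proof -
  interpret R: prob_space riesz_measure by (rule prob_space_riesz_measure)
  obtain B where B: "0 \<le> B" "\<And>x. \<bar>f x\<bar> \<le> B" using f by (rule bdd_lipschitzE) blast
  \<comment> \<open>The \<open>+ 1\<close> keeps the denominator positive when
    \<open>B = 0\<close>.\<close>
  define c where "c = 1 / (2 * B + 1)"
  have c: "0 < c" "c * (2 * B) \<le> 1" using B(1) by (auto simp: c_def field_simps)
  define g where "g x = c * (f x + B)" for x
  have g: "bdd_lipschitz g" unfolding g_def
    by (intro bdd_lipschitz_cmult bdd_lipschitz_add f bdd_lipschitz_const)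
  have g_bd: "0 \<le> g x" "g x \<le> 1" for x
  proof -
    have "0 \<le> f x + B" "f x + B \<le> 2 * B" using B(2)[of x] by auto
    then have "0 \<le> c * (f x + B)" "c * (f x + B) \<le> c * (2 * B)"
      using c(1) by (auto intro: mult_nonneg_nonneg mult_left_mono)
    then show "0 \<le> g x" "g x \<le> 1"
      using c(2) by (auto simp: g_def)
  qed
  have f_meas: "f \<in> borel_measurable riesz_measure"
    using bdd_lipschitz_measurable[OF f] by (simp cong: measurable_cong_sets)
  have f_int: "integrable riesz_measure f"
    using B by (intro R.integrable_const_bound[where B=B] f_meas) auto
  have g_int: "integrable riesz_measure g" unfolding g_def using f_int by auto
  have "L g \<le> (\<integral>x. g x \<partial>riesz_measure)"
    by (rule functional_le_integral[OF g g_bd])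
  moreover have "L (\<lambda>x. 1 - g x) \<le> (\<integral>x. 1 - g x \<partial>riesz_measure)"
    using g_bd by (intro functional_le_integral bdd_lipschitz_diff bdd_lipschitz_const g) auto
  moreover have "L (\<lambda>x. 1 - g x) = 1 - L g" by (simp add: diff[OF bdd_lipschitz_const g] const)
  moreover have "(\<integral>x. 1 - g x \<partial>riesz_measure) = 1 - (\<integral>x. g x \<partial>riesz_measure)"
    using g_int R.prob_space by simp
  ultimately have "L g = (\<integral>x. g x \<partial>riesz_measure)" by linarith
  moreover have "L g = c * (L f + B)"
    unfolding g_def using f
    by (subst cmult, (intro bdd_lipschitz_add bdd_lipschitz_const f), subst add)
       (auto simp: const bdd_lipschitz_const)
  moreover have "(\<integral>x. g x \<partial>riesz_measure) = c * ((\<integral>x. f x \<partial>riesz_measure) + B)"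
    unfolding g_def using f_int R.prob_space by simp
  ultimately show ?thesis using c by simp
qed

end

section \<open>Weak convergence\<close>

lemma prob_algebra_borelD:
  assumes "\<mu> \<in> space (prob_algebra borel)"
  shows "prob_space \<mu>" "sets \<mu> = sets borel" "space \<mu> = UNIV"
  using assms by (auto simp: space_prob_algebra dest: sets_eq_imp_space_eq)

lemma integrable_bounded_borel:
  fixes f :: "'a::topological_space \<Rightarrow> real"
  assumes "\<mu> \<in> space (prob_algebra borel)" "f \<in> borel_measurable borel" "\<And>x. \<bar>f x\<bar> \<le> B"
  shows "integrable \<mu> f"
proof -
  interpret prob_space \<mu> by (rule prob_algebra_borelD[OF assms(1)])
  show ?thesis
    using assms(2,3) prob_algebra_borelD(2)[OF assms(1)]
    by (intro integrable_const_bound[where B=B]) (auto cong: measurable_cong_sets)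
qed

lemma integral_inner_approx_tendsto:
  assumes \<mu>: "\<mu> \<in> space (prob_algebra borel)" and U: "open U"
  shows "(\<lambda>n. \<integral>x. inner_approx U n x \<partial>\<mu>) \<longlonglongrightarrow> measure \<mu> U"
proof -
  interpret prob_space \<mu> by (rule prob_algebra_borelD[OF \<mu>])
  have [simp]: "sets \<mu> = sets borel" by (rule prob_algebra_borelD[OF \<mu>])
  have meas: "h \<in> borel_measurable \<mu>" if "h \<in> borel_measurable borel" for h :: "'a \<Rightarrow> real"
    using that by (simp cong: measurable_cong_sets)
  have "(\<lambda>n. \<integral>x. inner_approx U n x \<partial>\<mu>) \<longlonglongrightarrow> (\<integral>x. indicator U x \<partial>\<mu>)"
  proof (rule integral_dominated_convergence[where w="\<lambda>_. 1"])
    show "AE x in \<mu>. (\<lambda>n. inner_approx U n x) \<longlonglongrightarrow> indicator U x"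
      using inner_approx_tendsto[OF U] by simp
    show "AE x in \<mu>. norm (inner_approx U n x) \<le> 1" for n
      using inner_approx_bounds[of U n] by simp
  qed (use U in \<open>auto intro: meas bdd_lipschitz_measurable bdd_lipschitz_inner_approx\<close>)
  then show ?thesis using prob_algebra_borelD(3)[OF \<mu>] by simp
qed

text \<open>The open sets are a generating pi-system, and their indicators are increasing limits of
  Lipschitz functions.\<close>

lemma prob_measure_eqI_bdd_lipschitz:
  fixes \<mu> \<nu> :: "'a::metric_space measure"
  assumes \<mu>: "\<mu> \<in> space (prob_algebra borel)" and \<nu>: "\<nu> \<in> space (prob_algebra borel)"
    and eq: "\<And>f. bdd_lipschitz f \<Longrightarrow> (\<integral>x. f x \<partial>\<mu>) = (\<integral>x. f x \<partial>\<nu>)"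
  shows "\<mu> = \<nu>"
proof -
  interpret \<mu>: prob_space \<mu> by (rule prob_algebra_borelD[OF \<mu>])
  interpret \<nu>: prob_space \<nu> by (rule prob_algebra_borelD[OF \<nu>])
  show ?thesis
  proof (rule measure_eqI_generator_eq[where \<Omega>=UNIV and E="{U. open U}" and A="\<lambda>_. UNIV"])
    show "Int_stable {U :: 'a set. open U}" by (auto simp: Int_stable_def)
    show "sets \<mu> = sigma_sets UNIV {U. open U}" "sets \<nu> = sigma_sets UNIV {U. open U}"
      using prob_algebra_borelD(2)[OF \<mu>] prob_algebra_borelD(2)[OF \<nu>] by (simp_all add: borel_def)
    show "emeasure \<mu> U = emeasure \<nu> U" if "U \<in> {U. open U}" for U
    proof -
      have "(\<lambda>n. \<integral>x. inner_approx U n x \<partial>\<mu>) \<longlonglongrightarrow> measure \<nu> U"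
        using integral_inner_approx_tendsto[OF \<nu>, of U] that
        by (simp add: eq[OF bdd_lipschitz_inner_approx])
      with integral_inner_approx_tendsto[OF \<mu>, of U] that have "measure \<mu> U = measure \<nu> U"
        by (auto intro: LIMSEQ_unique)
      then show ?thesis by (simp add: \<mu>.emeasure_eq_measure \<nu>.emeasure_eq_measure)
    qed
  qed (use \<mu>.emeasure_finite in auto)
qed

text \<open>The approximations are the Pasch-Hausdorff envelopes: \<open>h k\<close> is the largest
  function below \<open>f\<close> with Lipschitz constant \<open>k\<close>. Points at distance at
  least \<open>d\<close> from \<open>x\<close> cannot lower the infimum below \<open>f x\<close>
  once \<open>k * d > 2 * B\<close>, so in the limit only values near \<open>x\<close>
  count.\<close>

lemma bdd_lipschitz_approx_below:
  fixes f :: "'a::metric_space \<Rightarrow> real"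
  assumes cont: "continuous_on UNIV f" and B: "\<And>x. \<bar>f x\<bar> \<le> B"
  obtains h where "\<And>k::nat. bdd_lipschitz (h k)" "\<And>k x. \<bar>h k x\<bar> \<le> B" "\<And>k x. h k x \<le> f x"
    "\<And>x. (\<lambda>k. h k x) \<longlonglongrightarrow> f x"
proof
  define h where "h k x = (INF y. f y + real k * dist x y)" for k x
  have bb: "bdd_below (range (\<lambda>y. f y + real k * dist x y))" for k x
  proof (rule bdd_belowI2)
    show "- B \<le> f y + real k * dist x y" for y
    proof -
      have "0 \<le> real k * dist x y" by simp
      then show ?thesis using B[of y] by linarith
    qed
  qed
  show le: "h k x \<le> f x" for k x
    unfolding h_def using cINF_lower[OF bb, of x k x] by simp
  have ge: "- B \<le> h k x" for k x
    unfolding h_def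
  proof (rule cINF_greatest)
    show "- B \<le> f y + real k * dist x y" for y
    proof -
      have "0 \<le> real k * dist x y" by simp
      then show ?thesis using B[of y] by linarith
    qed
  qed simp
  show bd: "\<bar>h k x\<bar> \<le> B" for k x using le[of k x] ge[of k x] B[of x] by linarith
  have lip: "h k x \<le> h k z + real k * dist x z" for k x z
  proof -
    have "h k x - real k * dist x z \<le> h k z"
      unfolding h_def[of k z]
    proof (rule cINF_greatest)
      fix y
      have "h k x \<le> f y + real k * dist x y"
        unfolding h_def by (rule cINF_lower[OF bb]) simp
      also have "real k * dist x y \<le> real k * (dist x z + dist z y)"
        by (intro mult_left_mono dist_triangle) simp
      finally show "h k x - real k * dist x z \<le> f y + real k * dist z y"
        by (simp add: algebra_simps)
    qed simp
    then show ?thesis by simp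
  qed
  show "bdd_lipschitz (h k)" for k
  proof (rule bdd_lipschitzI[OF bd])
    show "\<bar>h k x - h k z\<bar> \<le> real k * dist x z" for x z
      using lip[of k x z] lip[of k z x] by (simp add: dist_commute abs_le_iff)
  qed
  show "(\<lambda>k. h k x) \<longlonglongrightarrow> f x" for x
  proof (rule LIMSEQ_I)
    fix e :: real assume e: "0 < e"
    obtain d where d: "0 < d" "\<And>y. dist y x < d \<Longrightarrow> dist (f y) (f x) < e / 2"
      using cont e unfolding continuous_on_iff by (metis UNIV_I half_gt_zero)
    obtain N :: nat where N: "2 * B < real N * d" using reals_Archimedean3[OF d(1)] by blast
    have "norm (h k x - f x) < e" if k: "k \<ge> N" for k
    proof -
      have "f x - e / 2 \<le> h k x"
        unfolding h_def
      proof (rule cINF_greatest)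
        fix y
        show "f x - e / 2 \<le> f y + real k * dist x y"
        proof (cases "dist x y < d")
          case True
          then have "dist (f y) (f x) < e / 2" by (intro d) (simp add: dist_commute)
          then have "f x - e / 2 \<le> f y" unfolding dist_real_def by linarith
          then show ?thesis by (simp add: add_increasing2)
        next
          case False
          then have "real N * d \<le> real k * dist x y"
            using k d(1) by (intro mult_mono) auto
          then show ?thesis using N B[of x] B[of y] e by linarith
        qed
      qed simp
      then show ?thesis using le[of k x] e by simp
    qed
    then show "\<exists>N. \<forall>k\<ge>N. norm (h k x - f x) < e" by blast
  qed
qed

text \<open>The approximation of a continuous \<open>f\<close> is not uniform, but being from below
  it bounds the integrals of \<open>f\<close> asymptotically from below; the same bound for
  \<open>- f\<close> gives the other half. Membership is asked only eventually because
  \<open>dual_semigroup\<close> is uncontrolled at negative times.\<close>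

lemma weakly_converges_bdd_lipschitzI:
  fixes \<mu> :: "'a::metric_space measure"
  assumes \<nu>: "\<forall>\<^sub>F i in G. \<nu> i \<in> space (prob_algebra borel)" and \<mu>: "\<mu> \<in> space (prob_algebra borel)"
    and lim: "\<And>f. bdd_lipschitz f \<Longrightarrow> ((\<lambda>i. \<integral>x. f x \<partial>\<nu> i) \<longlongrightarrow> (\<integral>x. f x \<partial>\<mu>)) G"
  shows "weakly_converges \<nu> \<mu> G"
proof -
  interpret \<mu>: prob_space \<mu> by (rule prob_algebra_borelD[OF \<mu>])
  have lower: "\<forall>\<^sub>F i in G. (\<integral>x. f x \<partial>\<mu>) - e < (\<integral>x. f x \<partial>\<nu> i)"
    if cont: "continuous_on UNIV f" and B: "\<And>x. \<bar>f x\<bar> \<le> B" and e: "0 < e"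
    for f :: "'a \<Rightarrow> real" and B e
  proof -
    obtain h where h: "\<And>k::nat. bdd_lipschitz (h k)" "\<And>k x. \<bar>h k x\<bar> \<le> B" "\<And>k x. h k x \<le> f x"
      "\<And>x. (\<lambda>k. h k x) \<longlonglongrightarrow> f x"
      using bdd_lipschitz_approx_below[OF cont B] by blast
    have f_meas: "f \<in> borel_measurable borel" by (rule borel_measurable_continuous_onI[OF cont])
    have "(\<lambda>k. \<integral>x. h k x \<partial>\<mu>) \<longlonglongrightarrow> (\<integral>x. f x \<partial>\<mu>)"
    proof (rule integral_dominated_convergence[where w="\<lambda>_. B"])
      show "f \<in> borel_measurable \<mu>" "h k \<in> borel_measurable \<mu>" for k
        using f_meas bdd_lipschitz_measurable[OF h(1)[of k]] prob_algebra_borelD(2)[OF \<mu>]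
        by (simp_all cong: measurable_cong_sets)
    qed (use h in auto)
    then have "\<forall>\<^sub>F k in sequentially. (\<integral>x. f x \<partial>\<mu>) - e < (\<integral>x. h k x \<partial>\<mu>)"
      using e by (intro order_tendstoD(1)) auto
    then obtain k where k: "(\<integral>x. f x \<partial>\<mu>) - e < (\<integral>x. h k x \<partial>\<mu>)"
      by (auto simp: eventually_sequentially)
    have "\<forall>\<^sub>F i in G. (\<integral>x. f x \<partial>\<mu>) - e < (\<integral>x. h k x \<partial>\<nu> i)"
      by (rule order_tendstoD(1)[OF lim[OF h(1)] k])
    with \<nu> show ?thesis
    proof eventually_elim
      case (elim i)
      have "(\<integral>x. h k x \<partial>\<nu> i) \<le> (\<integral>x. f x \<partial>\<nu> i)"
        using elim(1) B h by (intro integral_mono integrable_bounded_borel[where B=B] f_meas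
            bdd_lipschitz_measurable) auto
      then show ?case using elim(2) by linarith
    qed
  qed
  show ?thesis
    unfolding weakly_converges_def
  proof (intro allI impI)
    fix f :: "'a \<Rightarrow> real" assume f: "continuous_on UNIV f \<and> bounded (range f)"
    then obtain B where B: "\<And>x. \<bar>f x\<bar> \<le> B" by (auto simp: bounded_iff)
    show "((\<lambda>i. \<integral>x. f x \<partial>\<nu> i) \<longlongrightarrow> (\<integral>x. f x \<partial>\<mu>)) G"
    proof (rule tendstoI)
      fix e :: real assume e: "0 < e"
      have "\<forall>\<^sub>F i in G. (\<integral>x. - f x \<partial>\<mu>) - e < (\<integral>x. - f x \<partial>\<nu> i)"
        using f B e by (intro lower[of "\<lambda>x. - f x" B] continuous_on_minus) auto
      moreover have "\<forall>\<^sub>F i in G. (\<integral>x. f x \<partial>\<mu>) - e < (\<integral>x. f x \<partial>\<nu> i)"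
        using f B e by (intro lower[of f B]) auto
      ultimately show "\<forall>\<^sub>F i in G. dist (\<integral>x. f x \<partial>\<nu> i) (\<integral>x. f x \<partial>\<mu>) < e"
        by eventually_elim (auto simp: dist_real_def)
    qed
  qed
qed

section \<open>The two-point gap of a non-expansive process\<close>

locale non_expansive_process = markov_process M F \<rho>
  for M :: "'w measure" and F :: "ennreal \<Rightarrow> 'w measure"
    and \<rho> :: "real \<Rightarrow> 'x::{metric_space, second_countable_topology} \<Rightarrow> 'w \<Rightarrow> 'x" +
  assumes non_expansive: "non_expansive M \<rho>"
begin

section \<open>The semigroup on bounded Lipschitz functions\<close>

definition semigroup :: "real \<Rightarrow> ('x \<Rightarrow> real) \<Rightarrow> 'x \<Rightarrow> real" where
  "semigroup t f x = (\<integral>\<omega>. f (\<rho> t x \<omega>) \<partial>M)"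

lemma measurable_comp_process:
  "0 \<le> t \<Longrightarrow> f \<in> borel_measurable borel \<Longrightarrow> (\<lambda>\<omega>. f (\<rho> t x \<omega>)) \<in> borel_measurable M"
  using measurable_compose[OF measurable_rho] by blast

lemma integrable_comp_process:
  fixes f :: "'x \<Rightarrow> real"
  assumes "0 \<le> t" "f \<in> borel_measurable borel" "\<And>x. \<bar>f x\<bar> \<le> B"
  shows "integrable M (\<lambda>\<omega>. f (\<rho> t x \<omega>))"
  using assms by (intro integrable_const_bound[where B=B] measurable_comp_process) auto

lemma semigroup_abs_le:
  assumes "0 \<le> t" "f \<in> borel_measurable borel" "\<And>x. \<bar>f x\<bar> \<le> B"
  shows "\<bar>semigroup t f x\<bar> \<le> B"
proof -
  have "\<bar>semigroup t f x\<bar> \<le> (\<integral>\<omega>. \<bar>f (\<rho> t x \<omega>)\<bar> \<partial>M)"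
    unfolding semigroup_def by (rule integral_abs_bound)
  also have "\<dots> \<le> (\<integral>\<omega>. B \<partial>M)"
    using assms integrable_comp_process[OF assms] by (intro integral_mono integrable_abs) auto
  finally show ?thesis by (simp add: prob_space)
qed

text \<open>Here the given joint driving is exploited: both paths share the same outcome, so the
  pathwise contraction passes to expectations.\<close>

lemma semigroup_lipschitz:
  assumes t: "0 \<le> t" and f: "f \<in> borel_measurable borel" "\<And>x. \<bar>f x\<bar> \<le> A"
    and B: "0 \<le> B" "\<And>x y. \<bar>f x - f y\<bar> \<le> B * dist x y"
  shows "\<bar>semigroup t f x - semigroup t f y\<bar> \<le> B * dist x y"
proof -
  note int = integrable_comp_process[OF t f]
  have "\<bar>semigroup t f x - semigroup t f y\<bar> = \<bar>\<integral>\<omega>. f (\<rho> t x \<omega>) - f (\<rho> t y \<omega>) \<partial>M\<bar>"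
    unfolding semigroup_def by (simp add: int)
  also have "\<dots> \<le> (\<integral>\<omega>. \<bar>f (\<rho> t x \<omega>) - f (\<rho> t y \<omega>)\<bar> \<partial>M)"
    by (rule integral_abs_bound)
  also have "\<dots> \<le> (\<integral>\<omega>. B * dist x y \<partial>M)"
  proof (rule integral_mono_AE)
    show "AE \<omega> in M. \<bar>f (\<rho> t x \<omega>) - f (\<rho> t y \<omega>)\<bar> \<le> B * dist x y"
      using non_expansive[unfolded non_expansive_def, rule_format, of x y]
    proof eventually_elim
      case (elim \<omega>)
      then have "B * dist (\<rho> t x \<omega>) (\<rho> t y \<omega>) \<le> B * dist x y"
        using t B(1) by (intro mult_left_mono) auto
      then show ?case using B(2)[of "\<rho> t x \<omega>" "\<rho> t y \<omega>"] by linarith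
    qed
  qed (auto intro!: int)
  finally show ?thesis by (simp add: prob_space)
qed

lemma bdd_lipschitz_semigroup:
  assumes "0 \<le> t" "bdd_lipschitz f" shows "bdd_lipschitz (semigroup t f)"
proof -
  obtain B where B: "0 \<le> B" "\<And>x. \<bar>f x\<bar> \<le> B" "\<And>x y. \<bar>f x - f y\<bar> \<le> B * dist x y"
    using assms(2) by (rule bdd_lipschitzE) blast
  note meas = bdd_lipschitz_measurable[OF assms(2)]
  show ?thesis
    by (rule bdd_lipschitzI[OF semigroup_abs_le[OF assms(1) meas B(2)]
        semigroup_lipschitz[OF assms(1) meas B(2) B(1,3)]])
qed

text \<open>Chapman-Kolmogorov: integrating the Markov property removes the conditional
  expectation.\<close>

lemma semigroup_add:
  assumes s: "0 \<le> s" and t: "0 \<le> t" and bl: "bdd_lipschitz f"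
  shows "semigroup (s + t) f x = semigroup s (semigroup t f) x"
proof -
  have "subalgebra M (F (ennreal s))"
    using sets_F_subset by (auto simp: subalgebra_def space_F)
  then interpret sub: finite_measure_subalgebra M "F (ennreal s)"
    by unfold_locales
  note f = bdd_lipschitz_measurable[OF bl] bdd_lipschitz_bounded[OF bl]
  obtain B where B: "\<And>x. \<bar>f x\<bar> \<le> B" using f(2) by (auto simp: bounded_iff)
  have int: "integrable M (\<lambda>\<omega>. f (\<rho> (s + t) x \<omega>))"
    using s t f B by (intro integrable_comp_process[where B=B]) auto
  have "semigroup (s + t) f x
      = (\<integral>\<omega>. real_cond_exp M (F (ennreal s)) (\<lambda>\<omega>'. f (\<rho> (s + t) x \<omega>')) \<omega> \<partial>M)"
    unfolding semigroup_def by (rule sub.real_cond_exp_int(2)[OF int, symmetric])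
  also have "\<dots> = (\<integral>\<omega>. semigroup t f (\<rho> s x \<omega>) \<partial>M)"
    using markov_property[OF s t f, of x] bdd_lipschitz_measurable[OF bdd_lipschitz_semigroup[OF t bl]] s
    by (intro integral_cong_AE borel_measurable_cond_exp2 measurable_comp_process)
       (auto simp: semigroup_def[abs_def])
  finally show ?thesis by (simp add: semigroup_def[of s])
qed

text \<open>The supremum over all later times makes the gap monotone in \<open>t\<close> without any information on the
  monotonicity of \<open>\<lambda>s. semigroup s f x - semigroup s f y\<close>.\<close>

definition gap :: "('x \<Rightarrow> real) \<Rightarrow> real \<Rightarrow> 'x \<Rightarrow> 'x \<Rightarrow> real" where
  "gap f t x y = (SUP s\<in>{t..}. \<bar>semigroup s f x - semigroup s f y\<bar>)"

text \<open>As \<open>gap\<close> is antitone in time, integer times give the same infimum as all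
  times, and they allow sequential limit theorems for measurability and integration.\<close>

definition limit_gap :: "('x \<Rightarrow> real) \<Rightarrow> 'x \<Rightarrow> 'x \<Rightarrow> real" where
  "limit_gap f x y = (INF n::nat. gap f (real n) x y)"

section \<open>Estimates on the gap of a fixed Lipschitz function\<close>

context
  fixes f :: "'x \<Rightarrow> real" and B :: real
  assumes B: "0 \<le> B" "\<And>x. \<bar>f x\<bar> \<le> B" "\<And>x y. \<bar>f x - f y\<bar> \<le> B * dist x y"
begin

lemma f_bdd_lipschitz: "bdd_lipschitz f"
  using B by (intro bdd_lipschitzI)

lemma semigroup_bounds:
  assumes "0 \<le> t"
  shows "\<bar>semigroup t f x\<bar> \<le> B" "\<bar>semigroup t f x - semigroup t f y\<bar> \<le> B * dist x y"
  using semigroup_abs_le[OF assms bdd_lipschitz_measurable[OF f_bdd_lipschitz] B(2)]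
    semigroup_lipschitz[OF assms bdd_lipschitz_measurable[OF f_bdd_lipschitz] B(2,1,3)] by auto

lemma gap_bdd_above: "0 \<le> t \<Longrightarrow> bdd_above ((\<lambda>s. \<bar>semigroup s f x - semigroup s f y\<bar>) ` {t..})"
  by (rule bdd_aboveI2[where M="B * dist x y"]) (auto intro: semigroup_bounds)

lemma gap_upper: "0 \<le> t \<Longrightarrow> t \<le> s \<Longrightarrow> \<bar>semigroup s f x - semigroup s f y\<bar> \<le> gap f t x y"
  unfolding gap_def by (rule cSUP_upper[OF _ gap_bdd_above]) auto

lemma gap_least: "(\<And>s. t \<le> s \<Longrightarrow> \<bar>semigroup s f x - semigroup s f y\<bar> \<le> c) \<Longrightarrow> gap f t x y \<le> c"
  unfolding gap_def by (rule cSUP_least) auto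

lemma gap_nonneg: "0 \<le> t \<Longrightarrow> 0 \<le> gap f t x y"
  using gap_upper[of t t x y] by linarith

lemma gap_le_dist: "0 \<le> t \<Longrightarrow> gap f t x y \<le> B * dist x y"
  by (rule gap_least) (auto intro: semigroup_bounds)

lemma gap_le: "0 \<le> t \<Longrightarrow> gap f t x y \<le> 2 * B"
proof (rule gap_least)
  fix s assume "0 \<le> t" "t \<le> s"
  then show "\<bar>semigroup s f x - semigroup s f y\<bar> \<le> 2 * B"
    using semigroup_bounds(1)[of s x] semigroup_bounds(1)[of s y] by linarith
qed

lemma gap_antimono: "0 \<le> s \<Longrightarrow> s \<le> t \<Longrightarrow> gap f t x y \<le> gap f s x y"
  by (rule gap_least) (auto intro: gap_upper)

lemma gap_triangle: "0 \<le> t \<Longrightarrow> gap f t x y \<le> gap f t x' y' + B * (dist x x' + dist y y')"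
proof (rule gap_least)
  fix s assume s: "0 \<le> t" "t \<le> s"
  show "\<bar>semigroup s f x - semigroup s f y\<bar> \<le> gap f t x' y' + B * (dist x x' + dist y y')"
    using s semigroup_bounds(2)[of s x x'] semigroup_bounds(2)[of s y y'] gap_upper[OF s, of x' y']
    unfolding distrib_left by linarith
qed

lemma gap_tendsto: "(\<lambda>n. gap f (real n) x y) \<longlonglongrightarrow> limit_gap f x y"
  unfolding limit_gap_def
  by (rule LIMSEQ_decseq_INF)
     (auto intro!: bdd_belowI2[where m=0] gap_nonneg gap_antimono simp: decseq_def)

lemma limit_gap_le_gap: "limit_gap f x y \<le> gap f (real n) x y"
  unfolding limit_gap_def
  by (rule cINF_lower) (auto intro!: bdd_belowI2[where m=0] gap_nonneg)

lemma limit_gap_bounds: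
  "0 \<le> limit_gap f x y" "limit_gap f x y \<le> 2 * B" "limit_gap f x y \<le> B * dist x y"
  using limit_gap_le_gap[of x y 0] gap_le[of 0 x y] gap_le_dist[of 0 x y]
  by (auto intro!: LIMSEQ_le_const[OF gap_tendsto] gap_nonneg)

lemma limit_gap_triangle:
  "limit_gap f x y \<le> limit_gap f x' y' + B * (dist x x' + dist y y')"
  by (rule LIMSEQ_le[OF gap_tendsto tendsto_add[OF gap_tendsto tendsto_const]])
     (use gap_triangle in auto)

lemma continuous_limit_gap: "continuous_on A (\<lambda>(x, y). limit_gap f x y)"
  and continuous_gap: "0 \<le> t \<Longrightarrow> continuous_on A (\<lambda>(x, y). gap f t x y)"
proof -
  have *: "continuous_on A (\<lambda>(x, y). g x y)"
    if g: "\<And>x y x' y'. g x y \<le> g x' y' + B * (dist x x' + dist y y')" for g :: "'x \<Rightarrow> 'x \<Rightarrow> real"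
  proof -
    have "(2 * B)-lipschitz_on A (\<lambda>(x, y). g x y)"
    proof (rule lipschitz_onI)
      fix p q :: "'x \<times> 'x"
      have "B * (dist (fst p) (fst q) + dist (snd p) (snd q)) \<le> B * (2 * dist p q)"
        using dist_fst_le[of p q] dist_snd_le[of p q] B(1) by (intro mult_left_mono) auto
      then show "dist (case p of (x, y) \<Rightarrow> g x y) (case q of (x, y) \<Rightarrow> g x y) \<le> 2 * B * dist p q"
        using g[of "fst p" "snd p" "fst q" "snd q"] g[of "fst q" "snd q" "fst p" "snd p"]
        by (auto simp: dist_real_def dist_commute case_prod_beta)
    qed (use B in auto)
    then show ?thesis by (rule lipschitz_on_continuous_on)
  qed
  show "continuous_on A (\<lambda>(x, y). limit_gap f x y)"
    by (rule *) (rule limit_gap_triangle)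
  show "continuous_on A (\<lambda>(x, y). gap f t x y)" if "0 \<le> t"
    by (rule *) (rule gap_triangle[OF that])
qed

text \<open>Only the one-point laws enter, so the two points may be driven independently.\<close>

lemma gap_le_integral:
  assumes s: "0 \<le> s" and t: "0 \<le> t"
  shows "gap f (t + s) x y \<le> (\<integral>p. gap f s (\<rho> t x (fst p)) (\<rho> t y (snd p)) \<partial>(M \<Otimes>\<^sub>M M))"
    and "integrable (M \<Otimes>\<^sub>M M) (\<lambda>p. gap f s (\<rho> t x (fst p)) (\<rho> t y (snd p)))"
proof -
  interpret MM: pair_prob_space M M ..
  note [measurable] = measurable_rho[OF t]
  have meas: "(\<lambda>p. h (\<rho> t x (fst p)) (\<rho> t y (snd p))) \<in> borel_measurable (M \<Otimes>\<^sub>M M)"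
    if "continuous_on UNIV (\<lambda>(x, y). h x y)" for h :: "'x \<Rightarrow> 'x \<Rightarrow> real"
  proof -
    have "(\<lambda>(x, y). h x y) \<in> borel_measurable (borel \<Otimes>\<^sub>M borel)"
      using borel_measurable_continuous_onI[OF that] by (simp add: borel_prod)
    from measurable_compose[OF _ this, of "\<lambda>p. (\<rho> t x (fst p), \<rho> t y (snd p))" "M \<Otimes>\<^sub>M M"]
    show ?thesis by simp
  qed
  show int: "integrable (M \<Otimes>\<^sub>M M) (\<lambda>p. gap f s (\<rho> t x (fst p)) (\<rho> t y (snd p)))"
    using gap_le[OF s] gap_nonneg[OF s]
    by (intro MM.integrable_const_bound[where B="2 * B"] meas continuous_gap[OF s]) auto
  show "gap f (t + s) x y \<le> (\<integral>p. gap f s (\<rho> t x (fst p)) (\<rho> t y (snd p)) \<partial>(M \<Otimes>\<^sub>M M))"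
  proof (rule gap_least)
    fix r assume r: "t + s \<le> r"
    \<comment> \<open>The semigroup law writes the value at time \<open>r\<close> as the expectation
      of \<open>h\<close> at time \<open>t\<close>. As \<open>r - t\<close> is at least
      \<open>s\<close>, differences of \<open>h\<close> are bounded by
      \<open>gap f s\<close>.\<close>
    define h where "h = semigroup (r - t) f"
    have rt: "0 \<le> r - t" using r s by simp
    have h_bl: "bdd_lipschitz h"
      unfolding h_def using rt f_bdd_lipschitz by (rule bdd_lipschitz_semigroup)
    note h_meas [measurable] = bdd_lipschitz_measurable[OF h_bl]
    have h_bd: "\<bar>h z\<bar> \<le> B" for z unfolding h_def by (rule semigroup_bounds[OF rt])
    have sg: "semigroup r f z = (\<integral>\<omega>. h (\<rho> t z \<omega>) \<partial>M)" for z
      using semigroup_add[OF t rt f_bdd_lipschitz, of z]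
      by (simp add: h_def semigroup_def)
    have h_int: "integrable M (\<lambda>\<omega>. h (\<rho> t z \<omega>))" for z
      by (rule integrable_comp_process[OF t h_meas h_bd])
    have int_diff: "integrable (M \<Otimes>\<^sub>M M) (\<lambda>p. h (\<rho> t x (fst p)) - h (\<rho> t y (snd p)))"
    proof (rule MM.integrable_const_bound[where B="2 * B"])
      have "\<bar>h a - h b\<bar> \<le> 2 * B" for a b using h_bd[of a] h_bd[of b] by linarith
      then show "AE p in M \<Otimes>\<^sub>M M. norm (h (\<rho> t x (fst p)) - h (\<rho> t y (snd p))) \<le> 2 * B" by simp
    qed simp
    have "semigroup r f x - semigroup r f y = (\<integral>\<omega>. (\<integral>\<omega>'. h (\<rho> t x \<omega>) - h (\<rho> t y \<omega>') \<partial>M) \<partial>M)"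
      using h_int by (simp add: sg prob_space)
    also have "\<dots> = (\<integral>p. h (\<rho> t x (fst p)) - h (\<rho> t y (snd p)) \<partial>(M \<Otimes>\<^sub>M M))"
      using MM.integral_fst'[OF int_diff] by simp
    finally have "\<bar>semigroup r f x - semigroup r f y\<bar>
        \<le> (\<integral>p. \<bar>h (\<rho> t x (fst p)) - h (\<rho> t y (snd p))\<bar> \<partial>(M \<Otimes>\<^sub>M M))"
      using integral_abs_bound[of "M \<Otimes>\<^sub>M M"] by simp
    also have "\<dots> \<le> (\<integral>p. gap f s (\<rho> t x (fst p)) (\<rho> t y (snd p)) \<partial>(M \<Otimes>\<^sub>M M))"
      using r s by (intro integral_mono integrable_abs int_diff int) (auto simp: h_def intro: gap_upper)
    finally show "\<bar>semigroup r f x - semigroup r f y\<bar>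
        \<le> (\<integral>p. gap f s (\<rho> t x (fst p)) (\<rho> t y (snd p)) \<partial>(M \<Otimes>\<^sub>M M))" .
  qed
qed

text \<open>Passing to the limit in \<open>gap_le_integral\<close> bounds the limiting gap by its
  mean over independent copies at time \<open>t\<close>. The integrand is at most \<open>S\<close>
  everywhere and gains \<open>c\<close> on the event that the copies lie in \<open>U\<close> and
  \<open>V\<close>, whose probability factors by independence.\<close>

lemma limit_gap_contraction:
  assumes t: "0 \<le> t" and U: "U \<in> sets borel" and V: "V \<in> sets borel"
    and S: "\<And>x y. limit_gap f x y \<le> S" and c: "\<And>x y. x \<in> U \<Longrightarrow> y \<in> V \<Longrightarrow> limit_gap f x y \<le> S - c"
  shows "limit_gap f x y
    \<le> S - c * (prob {\<omega> \<in> space M. \<rho> t x \<omega> \<in> U} * prob {\<omega> \<in> space M. \<rho> t y \<omega> \<in> V})"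
proof -
  interpret MM: pair_prob_space M M ..
  note [measurable] = measurable_rho[OF t] U V
  let ?g = "\<lambda>n p. gap f (real n) (\<rho> t x (fst p)) (\<rho> t y (snd p))"
  let ?l = "\<lambda>p. limit_gap f (\<rho> t x (fst p)) (\<rho> t y (snd p))"
  let ?E = "{\<omega> \<in> space M. \<rho> t x \<omega> \<in> U} \<times> {\<omega> \<in> space M. \<rho> t y \<omega> \<in> V}"
  have int: "integrable (M \<Otimes>\<^sub>M M) (?g n)" for n
    using gap_le_integral(2)[OF _ t, of "real n"] by simp
  have l_meas: "?l \<in> borel_measurable (M \<Otimes>\<^sub>M M)"
    by (rule borel_measurable_LIMSEQ_real[OF gap_tendsto]) (use int in auto)
  have l_int: "integrable (M \<Otimes>\<^sub>M M) ?l"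
    using limit_gap_bounds by (intro MM.integrable_const_bound[where B="2 * B"] l_meas) auto
  have lim: "(\<lambda>n. \<integral>p. ?g n p \<partial>(M \<Otimes>\<^sub>M M)) \<longlonglongrightarrow> (\<integral>p. ?l p \<partial>(M \<Otimes>\<^sub>M M))"
  proof (rule integral_dominated_convergence[where w="\<lambda>_. 2 * B"])
    show "AE p in M \<Otimes>\<^sub>M M. norm (?g n p) \<le> 2 * B" for n
      using gap_le[of "real n"] gap_nonneg[of "real n"] by simp
  qed (use l_meas int gap_tendsto in auto)
  have "limit_gap f x y \<le> (\<integral>p. ?g n p \<partial>(M \<Otimes>\<^sub>M M))" for n
  proof -
    \<comment> \<open>\<open>limit_gap\<close> is an infimum over integer times only, so
      \<open>t\<close> is rounded up.\<close>
    have "limit_gap f x y \<le> gap f (real (nat \<lceil>t\<rceil> + n)) x y" by (rule limit_gap_le_gap)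
    also have "\<dots> \<le> gap f (t + real n) x y" using t by (intro gap_antimono) auto
    also have "\<dots> \<le> (\<integral>p. ?g n p \<partial>(M \<Otimes>\<^sub>M M))" by (rule gap_le_integral[OF _ t]) simp
    finally show ?thesis .
  qed
  then have "limit_gap f x y \<le> (\<integral>p. ?l p \<partial>(M \<Otimes>\<^sub>M M))"
    by (intro LIMSEQ_le_const[OF lim]) auto
  also have "\<dots> \<le> (\<integral>p. S - c * indicator ?E p \<partial>(M \<Otimes>\<^sub>M M))"
  proof (rule integral_mono[OF l_int])
    show "integrable (M \<Otimes>\<^sub>M M) (\<lambda>p. S - c * indicat_real ?E p)"
      by (intro Bochner_Integration.integrable_diff integrable_mult_right integrable_real_indicator)
         (auto simp: MM.P.emeasure_eq_measure)
    show "?l p \<le> S - c * indicator ?E p" for p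
      using S c by (auto simp: indicator_def)
  qed
  also have "\<dots> = S - c * measure (M \<Otimes>\<^sub>M M) ?E"
    by (subst Bochner_Integration.integral_diff)
       (auto simp: MM.P.emeasure_eq_measure MM.P.prob_space intro!: integrable_mult_right)
  also have "measure (M \<Otimes>\<^sub>M M) ?E
      = prob {\<omega> \<in> space M. \<rho> t x \<omega> \<in> U} * prob {\<omega> \<in> space M. \<rho> t y \<omega> \<in> V}"
    by (simp add: measure_def emeasure_pair_measure_Times enn2real_mult)
  finally show ?thesis .
qed

end

end

section \<open>Occupation of compact sets\<close>

text \<open>Joint measurability, as needed for Fubini: the process is the limit of its values at
  grid times to the left, and each discretised process is patched from countably many measurable
  maps. The \<open>max 0\<close> extends it to all real times, since nothing is known before time
  \<open>0\<close>.\<close>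

lemma measurable_continuous_paths:
  fixes X :: "real \<Rightarrow> 'w \<Rightarrow> 'x::metric_space"
  assumes meas: "\<And>t. 0 \<le> t \<Longrightarrow> X t \<in> borel_measurable M"
    and cont: "\<And>\<omega>. \<omega> \<in> space M \<Longrightarrow> continuous_on {0..} (\<lambda>t. X t \<omega>)"
  shows "(\<lambda>p. X (max 0 (fst p)) (snd p)) \<in> borel_measurable (borel \<Otimes>\<^sub>M M)"
proof (rule borel_measurable_LIMSEQ_metric)
  let ?i = "\<lambda>n p. \<lfloor>real (Suc n) * max 0 (fst p)\<rfloor>"
  show "(\<lambda>p. X (max 0 (real_of_int (?i n p) / real (Suc n))) (snd p)) \<in> borel_measurable (borel \<Otimes>\<^sub>M M)" for n
  proof (rule measurable_compose_countable[where g="?i n"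
        and f="\<lambda>i p. X (max 0 (real_of_int i / real (Suc n))) (snd p)"])
    show "(\<lambda>p. X (max 0 (real_of_int i / real (Suc n))) (snd p)) \<in> borel_measurable (borel \<Otimes>\<^sub>M M)" for i
      by (rule measurable_compose[OF measurable_snd meas]) simp
    show "?i n \<in> borel \<Otimes>\<^sub>M M \<rightarrow>\<^sub>M count_space UNIV" by measurable
  qed
next
  fix p assume p: "p \<in> space (borel \<Otimes>\<^sub>M M :: (real \<times> 'w) measure)"
  define s where "s = max 0 (fst p)"
  have s: "0 \<le> s" by (simp add: s_def)
  have lim: "(\<lambda>n. max 0 (real_of_int \<lfloor>real (Suc n) * s\<rfloor> / real (Suc n))) \<longlonglongrightarrow> s"
  proof (rule LIMSEQ_I)
    fix e :: real assume "0 < e"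
    then obtain N where N: "inverse (real (Suc N)) < e" using reals_Archimedean by blast
    have "norm (max 0 (real_of_int \<lfloor>real (Suc n) * s\<rfloor> / real (Suc n)) - s) < e" if n: "n \<ge> N" for n
    proof -
      have "inverse (real (Suc n)) \<le> inverse (real (Suc N))" using n by simp
      then have e: "1 / real (Suc n) < e" using N by (simp add: inverse_eq_divide)
      have 1: "real_of_int \<lfloor>real (Suc n) * s\<rfloor> \<le> real (Suc n) * s"
        "real (Suc n) * s < real_of_int \<lfloor>real (Suc n) * s\<rfloor> + 1" by linarith+
      have "real_of_int \<lfloor>real (Suc n) * s\<rfloor> / real (Suc n) \<le> s"
        using 1(1) by (simp add: divide_le_eq mult.commute)
      moreover have "s < (real_of_int \<lfloor>real (Suc n) * s\<rfloor> + 1) / real (Suc n)"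
        using 1(2) by (simp add: less_divide_eq mult.commute)
      then have "s < real_of_int \<lfloor>real (Suc n) * s\<rfloor> / real (Suc n) + 1 / real (Suc n)"
        by (simp add: add_divide_distrib)
      moreover have "0 \<le> real_of_int \<lfloor>real (Suc n) * s\<rfloor> / real (Suc n)"
        using s by simp
      ultimately show ?thesis using e unfolding real_norm_def by linarith
    qed
    then show "\<exists>N. \<forall>n\<ge>N. norm (max 0 (real_of_int \<lfloor>real (Suc n) * s\<rfloor> / real (Suc n)) - s) < e"
      by blast
  qed
  have "snd p \<in> space M" using p by (auto simp: space_pair_measure)
  from continuous_on_tendsto_compose[OF cont[OF this] lim] s
  show "(\<lambda>n. X (max 0 (real_of_int \<lfloor>real (Suc n) * max 0 (fst p)\<rfloor> / real (Suc n))) (snd p))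
      \<longlonglongrightarrow> X (max 0 (fst p)) (snd p)"
    by (simp add: s_def)
qed

context markov_process
begin

text \<open>Joint measurability asks for continuity of every path, but the process has it only
  almost surely. On the exceptional null set the path is made constant; this set does not depend on
  the time.\<close>

lemma continuous_version:
  obtains X where "\<And>t. 0 \<le> t \<Longrightarrow> X t \<in> M \<rightarrow>\<^sub>M borel"
    "\<And>\<omega>. continuous_on {0..} (\<lambda>t. X t \<omega>)" "AE \<omega> in M. \<forall>t. X t \<omega> = \<rho> t x \<omega>"
proof -
  obtain N where N: "N \<in> null_sets M" "\<And>\<omega>. \<omega> \<in> space M - N \<Longrightarrow> continuous_on {0..} (\<lambda>t. \<rho> t x \<omega>)"
    using AE_E3[OF continuous_paths[of x]] by blast
  define X where "X t \<omega> = (if \<omega> \<in> space M - N then \<rho> t x \<omega> else x)" for t \<omega>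
  have [measurable]: "N \<in> sets M" using N(1) by auto
  show ?thesis
  proof
    show "X t \<in> M \<rightarrow>\<^sub>M borel" if "0 \<le> t" for t
      unfolding X_def using measurable_rho[OF that] by (intro measurable_If) auto
    show "continuous_on {0..} (\<lambda>t. X t \<omega>)" for \<omega>
      using N(2)[of \<omega>] by (cases "\<omega> \<in> space M - N") (auto simp: X_def)
    show "AE \<omega> in M. \<forall>t. X t \<omega> = \<rho> t x \<omega>"
      using AE_not_in[OF N(1)] by (auto simp: X_def)
  qed
qed

text \<open>Markov's inequality for occupation times: by Fubini the time integral of the
  probabilities is the expected time spent in \<open>U\<close>, and there \<open>h\<close> is at
  least \<open>r\<close>. The continuous version provides the joint measurability.\<close>

lemma measurable_prob_process:
  assumes U: "U \<in> sets borel"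
  shows "(\<lambda>t. emeasure M {\<omega> \<in> space M. \<rho> (max 0 t) x \<omega> \<in> U}) \<in> borel_measurable borel"
    and occupation_time_le: "(\<And>z. z \<in> U \<Longrightarrow> r \<le> h z) \<Longrightarrow>
      r * (\<integral>\<^sup>+t. emeasure M {\<omega> \<in> space M. \<rho> (max 0 t) x \<omega> \<in> U} * indicator {0..T} t \<partial>lborel)
      \<le> (\<integral>\<^sup>+\<omega>. (\<integral>\<^sup>+t. h (\<rho> t x \<omega>) * indicator {0..T} t \<partial>lborel) \<partial>M)"
proof -
  interpret P: pair_sigma_finite lborel M ..
  obtain X where X: "\<And>t. 0 \<le> t \<Longrightarrow> X t \<in> M \<rightarrow>\<^sub>M borel"
    "\<And>\<omega>. continuous_on {0..} (\<lambda>t. X t \<omega>)" "AE \<omega> in M. \<forall>t. X t \<omega> = \<rho> t x \<omega>"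
    using continuous_version by blast
  have joint: "(\<lambda>p. X (max 0 (fst p)) (snd p)) \<in> lborel \<Otimes>\<^sub>M M \<rightarrow>\<^sub>M borel"
    using measurable_continuous_paths[of X M, OF X(1,2)]
    by (simp cong: measurable_cong_sets add: measurable_cong_sets[OF sets_pair_measure_cong[OF sets_lborel refl] refl])
  note [measurable] = joint U
  have eq: "emeasure M {\<omega> \<in> space M. \<rho> (max 0 t) x \<omega> \<in> U}
      = (\<integral>\<^sup>+\<omega>. indicator U (X (max 0 t) \<omega>) \<partial>M)" for t
  proof -
    have [measurable]: "X (max 0 t) \<in> M \<rightarrow>\<^sub>M borel" "\<rho> (max 0 t) x \<in> M \<rightarrow>\<^sub>M borel"
      using X(1) measurable_rho by auto
    have "emeasure M {\<omega> \<in> space M. \<rho> (max 0 t) x \<omega> \<in> U}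
        = (\<integral>\<^sup>+\<omega>. indicator {\<omega> \<in> space M. \<rho> (max 0 t) x \<omega> \<in> U} \<omega> \<partial>M)"
      by (subst nn_integral_indicator) auto
    also have "\<dots> = (\<integral>\<^sup>+\<omega>. indicator U (X (max 0 t) \<omega>) \<partial>M)"
      using X(3) AE_space by (intro nn_integral_cong_AE) (auto simp: indicator_def)
    finally show ?thesis .
  qed
  have "(\<lambda>p. indicator U (X (max 0 (fst p)) (snd p)) :: ennreal) \<in> borel_measurable (lborel \<Otimes>\<^sub>M M)"
    by measurable
  then have "(\<lambda>t. \<integral>\<^sup>+\<omega>. indicator U (X (max 0 t) \<omega>) \<partial>M) \<in> borel_measurable lborel"
    using borel_measurable_nn_integral_fst[of "\<lambda>p. indicator U (X (max 0 (fst p)) (snd p))" lborel] by simp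
  then show "(\<lambda>t. emeasure M {\<omega> \<in> space M. \<rho> (max 0 t) x \<omega> \<in> U}) \<in> borel_measurable borel"
    by (simp add: eq)
  have joint': "(\<lambda>(t, \<omega>). indicator U (X (max 0 t) \<omega>) * indicator {0..T} t :: ennreal)
      \<in> borel_measurable (lborel \<Otimes>\<^sub>M M)"
    by measurable
  assume h: "\<And>z. z \<in> U \<Longrightarrow> r \<le> h z"
  have "(\<integral>\<^sup>+t. emeasure M {\<omega> \<in> space M. \<rho> (max 0 t) x \<omega> \<in> U} * indicator {0..T} t \<partial>lborel)
      = (\<integral>\<^sup>+t. (\<integral>\<^sup>+\<omega>. indicator U (X (max 0 t) \<omega>) * indicator {0..T} t \<partial>M) \<partial>lborel)"
    using X(1) by (auto simp: eq intro!: nn_integral_cong nn_integral_multc[symmetric])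
  also have "\<dots> = (\<integral>\<^sup>+\<omega>. (\<integral>\<^sup>+t. indicator U (X (max 0 t) \<omega>) * indicator {0..T} t \<partial>lborel) \<partial>M)"
    by (rule P.Fubini'[OF joint', symmetric])
  also have "r * \<dots> = (\<integral>\<^sup>+\<omega>. (\<integral>\<^sup>+t. r * (indicator U (X (max 0 t) \<omega>) * indicator {0..T} t) \<partial>lborel) \<partial>M)"
  proof -
    have "(\<lambda>\<omega>. \<integral>\<^sup>+t. indicator U (X (max 0 t) \<omega>) * indicator {0..T} t \<partial>lborel) \<in> borel_measurable M"
      using measurable_pair_swap[OF joint'] by (intro lborel.borel_measurable_nn_integral) simp
    moreover have "(\<lambda>t. indicator U (X (max 0 t) \<omega>) * indicator {0..T} t :: ennreal) \<in> borel_measurable lborel"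
      if "\<omega> \<in> space M" for \<omega>
      using measurable_compose[OF measurable_Pair2'[OF that] joint'] by simp
    ultimately show ?thesis
      by (simp add: nn_integral_cmult cong: nn_integral_cong)
  qed
  also have "\<dots> \<le> (\<integral>\<^sup>+\<omega>. (\<integral>\<^sup>+t. h (\<rho> t x \<omega>) * indicator {0..T} t \<partial>lborel) \<partial>M)"
    using X(3) by (intro nn_integral_mono_AE) (auto intro!: nn_integral_mono simp: indicator_def h)
  finally show "r * (\<integral>\<^sup>+t. emeasure M {\<omega> \<in> space M. \<rho> (max 0 t) x \<omega> \<in> U} * indicator {0..T} t \<partial>lborel)
      \<le> (\<integral>\<^sup>+\<omega>. (\<integral>\<^sup>+t. h (\<rho> t x \<omega>) * indicator {0..T} t \<partial>lborel) \<partial>M)" .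
qed

text \<open>The set \<open>K\<close> is a sublevel set whose level depends only on \<open>C\<close>
  and \<open>e\<close>; the starting points and the shift affect only how long one has to wait. The
  shift \<open>a\<close> is what later lets two different late times be compared.\<close>

lemma common_return_times:
  assumes dis: "dissipation_estimate M \<rho>" and e: "0 < e"
  shows "\<exists>K. compact K \<and> (\<forall>x y. \<forall>a\<ge>0. \<exists>s\<ge>0.
    prob {\<omega> \<in> space M. \<rho> s x \<omega> \<notin> K} \<le> e \<and> prob {\<omega> \<in> space M. \<rho> (s + a) y \<omega> \<notin> K} \<le> e)"
proof -
  obtain \<Psi>1 \<Psi>2 :: "'x \<Rightarrow> real" and C where \<Psi>1: "\<And>x. 0 \<le> \<Psi>1 x" and \<Psi>2: "\<And>x. 0 \<le> \<Psi>2 x" and C: "0 < C"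
    and est: "\<And>x T. 0 \<le> T \<Longrightarrow>
        esssup (lebesgue_on {0..T}) (\<lambda>t. \<integral>\<^sup>+\<omega>. ennreal (\<Psi>1 (\<rho> t x \<omega>)) \<partial>M) +
        (\<integral>\<^sup>+\<omega>. (\<integral>\<^sup>+t. ennreal (\<Psi>2 (\<rho> t x \<omega>)) \<partial>lebesgue_on {0..T}) \<partial>M)
        \<le> ennreal (C * (T + \<Psi>1 x))"
    and cpt: "\<And>c. compact {x. \<Psi>2 x \<le> c}"
    using dis unfolding dissipation_estimate_def by blast
  \<comment> \<open>With this level the expected time outside \<open>K\<close> up to
    \<open>T\<close> is at most \<open>C / r = e / 4\<close> times
    \<open>T + \<Psi>1 x\<close>.\<close>
  define r where "r = 4 * C / e"
  have r: "0 < r" using C e by (auto simp: r_def)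
  define K where "K = {x. \<Psi>2 x \<le> r}"
  have K: "compact K" "- K \<in> sets borel" unfolding K_def using cpt[of r] by (auto dest: borel_compact)
  define q where "q x t = emeasure M {\<omega> \<in> space M. \<rho> (max 0 t) x \<omega> \<in> - K}" for x t
  have q_meas [measurable]: "q x \<in> borel_measurable borel" for x
    unfolding q_def using measurable_prob_process[OF K(2)] by simp
  have occ: "(\<integral>\<^sup>+t. q x t * indicator {0..T} t \<partial>lborel) \<le> ennreal (e / 4 * (T + \<Psi>1 x))"
    if T: "0 \<le> T" for x T
  proof -
    have "ennreal r * (\<integral>\<^sup>+t. q x t * indicator {0..T} t \<partial>lborel)
        \<le> (\<integral>\<^sup>+\<omega>. (\<integral>\<^sup>+t. ennreal (\<Psi>2 (\<rho> t x \<omega>)) * indicator {0..T} t \<partial>lborel) \<partial>M)"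
      unfolding q_def by (rule occupation_time_le[OF K(2)]) (auto simp: K_def intro!: ennreal_leI)
    also have "\<dots> = (\<integral>\<^sup>+\<omega>. (\<integral>\<^sup>+t. ennreal (\<Psi>2 (\<rho> t x \<omega>)) \<partial>lebesgue_on {0..T}) \<partial>M)"
      by (simp add: nn_integral_restrict_space nn_integral_completion)
    also have "\<dots> \<le> ennreal (C * (T + \<Psi>1 x))"
      using est[OF T, of x] by (rule order_trans[rotated]) simp
    also have "C * (T + \<Psi>1 x) = r * (e / 4 * (T + \<Psi>1 x))"
      using C e by (simp add: r_def)
    also have "ennreal \<dots> = ennreal r * ennreal (e / 4 * (T + \<Psi>1 x))"
      using r by (intro ennreal_mult') simp
    finally show ?thesis using r by (simp add: ennreal_mult_le_mult_iff)
  qed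
  have "\<exists>s\<ge>0. prob {\<omega> \<in> space M. \<rho> s x \<omega> \<notin> K} \<le> e \<and> prob {\<omega> \<in> space M. \<rho> (s + a) y \<omega> \<notin> K} \<le> e"
    if a: "0 \<le> a" for x y a
  proof (rule ccontr)
    assume neg: "\<not> (\<exists>s\<ge>0. prob {\<omega> \<in> space M. \<rho> s x \<omega> \<notin> K} \<le> e
      \<and> prob {\<omega> \<in> space M. \<rho> (s + a) y \<omega> \<notin> K} \<le> e)"
    define c where "c = a + \<Psi>1 x + \<Psi>1 y"
    \<comment> \<open>If one of the two probabilities exceeded \<open>e\<close> at each time in
      [0, T], the expected times outside \<open>K\<close> would sum to at least
      \<open>e * T\<close>. They sum to at most \<open>e / 4 * (2 * T + c)\<close>, the shifted path
      being observed within [0, T + a]. Any \<open>T > c / 2\<close> is therefore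
      contradictory.\<close>
    define T where "T = c + 1"
    have T: "0 \<le> T" "0 \<le> c" using a \<Psi>1[of x] \<Psi>1[of y] by (auto simp: T_def c_def)
    have q_prob: "q z s = ennreal (prob {\<omega> \<in> space M. \<rho> s z \<omega> \<notin> K})" if "0 \<le> s" for z s
      using that by (simp add: q_def emeasure_eq_measure)
    have "ennreal (e * T) = (\<integral>\<^sup>+t. ennreal e * indicator {0..T} t \<partial>lborel)"
      using T e by (simp add: nn_integral_cmult ennreal_mult')
    also have "\<dots> \<le> (\<integral>\<^sup>+t. q x t * indicator {0..T} t + q y (t + a) * indicator {0..T} t \<partial>lborel)"
    proof (rule nn_integral_mono)
      fix t
      show "ennreal e * indicator {0..T} t
          \<le> q x t * indicator {0..T} t + q y (t + a) * indicator {0..T} t"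
      proof (cases "t \<in> {0..T}")
        case True
        then have "ennreal e \<le> q x t \<or> ennreal e \<le> q y (t + a)"
        proof -
          have "e < prob {\<omega> \<in> space M. \<rho> t x \<omega> \<notin> K} \<or> e < prob {\<omega> \<in> space M. \<rho> (t + a) y \<omega> \<notin> K}"
            using neg True unfolding atLeastAtMost_iff not_le[symmetric] by blast
          then show ?thesis using True a by (auto simp: q_prob intro!: ennreal_leI)
        qed
        then show ?thesis using True by (auto intro: add_increasing add_increasing2)
      qed simp
    qed
    also have "\<dots> = (\<integral>\<^sup>+t. q x t * indicator {0..T} t \<partial>lborel)
        + (\<integral>\<^sup>+t. q y (t + a) * indicator {0..T} t \<partial>lborel)"
      by (rule nn_integral_add) measurable
    also have "(\<integral>\<^sup>+t. q y (t + a) * indicator {0..T} t \<partial>lborel)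
        \<le> (\<integral>\<^sup>+t. q y (a + t) * indicator {0..T + a} (a + t) \<partial>lborel)"
      using a by (intro nn_integral_mono) (auto simp: indicator_def add.commute)
    also have "\<dots> = (\<integral>\<^sup>+t. q y t * indicator {0..T + a} t \<partial>lborel)"
      using nn_integral_real_affine[of "\<lambda>t. q y t * indicator {0..T + a} t" 1 a] by simp
    also have "\<dots> \<le> ennreal (e / 4 * (T + a + \<Psi>1 y))"
      using T a by (intro occ) simp
    also have "(\<integral>\<^sup>+t. q x t * indicator {0..T} t \<partial>lborel) \<le> ennreal (e / 4 * (T + \<Psi>1 x))"
      by (rule occ[OF T(1)])
    finally have "ennreal (e * T) \<le> ennreal (e / 4 * (T + \<Psi>1 x)) + ennreal (e / 4 * (T + a + \<Psi>1 y))"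
      by (simp add: add_mono)
    also have "\<dots> = ennreal (e / 4 * (T + \<Psi>1 x) + e / 4 * (T + a + \<Psi>1 y))"
      using e T a \<Psi>1[of x] \<Psi>1[of y] by (intro ennreal_plus[symmetric] mult_nonneg_nonneg) auto
    also have "e / 4 * (T + \<Psi>1 x) + e / 4 * (T + a + \<Psi>1 y) = e / 4 * (2 * T + c)"
      by (simp add: c_def field_simps)
    finally have "e * T \<le> e / 4 * (2 * T + c)"
      using e T by (subst (asm) ennreal_le_iff) auto
    then have "T \<le> (2 * T + c) / 4" using e by (simp add: field_simps)
    then show False using T by (simp add: T_def)
  qed
  then show ?thesis using K(1) by blast
qed

end

section \<open>Tubes around the deterministic paths\<close>

context markov_process
begin

text \<open>No regularity of \<open>v\<close> is available.  A countable dense part of the graph of \<open>v\<close> over the bad times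
  allows one sample path to be chosen that stays away from \<open>v\<close> at all bad times simultaneously.\<close>

lemma avoiding_path:
  fixes v :: "real \<Rightarrow> 'x"
  assumes A: "measure M A > 0"
  shows "\<exists>\<omega>\<in>A. \<forall>t\<ge>0. prob {\<omega> \<in> space M. dist (\<rho> t x \<omega>) (v t) \<le> d} = 0
    \<longrightarrow> d \<le> dist (\<rho> t x \<omega>) (v t)"
proof -
  define N where "N = {t. 0 \<le> t \<and> prob {\<omega> \<in> space M. dist (\<rho> t x \<omega>) (v t) \<le> d} = 0}"
  \<comment> \<open>Density is taken in the graph and not just in the set of times: along the
    approximating times the values of \<open>v\<close> must converge as well.\<close>
  obtain D where D: "countable D" "D \<subseteq> (\<lambda>t. (t, v t)) ` N" "(\<lambda>t. (t, v t)) ` N \<subseteq> closure D"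
    by (rule separable)
  have "AE \<omega> in M. \<forall>p\<in>D. d < dist (\<rho> (fst p) x \<omega>) (snd p)"
  proof (rule AE_ball_countable')
    fix p assume "p \<in> D"
    then obtain t where t: "p = (t, v t)" "0 \<le> t" "prob {\<omega> \<in> space M. dist (\<rho> t x \<omega>) (v t) \<le> d} = 0"
      using D(2) by (auto simp: N_def)
    note [measurable] = measurable_rho[OF t(2), of x]
    have "{\<omega> \<in> space M. dist (\<rho> t x \<omega>) (v t) \<le> d} \<in> null_sets M"
      using t(3) by (intro null_setsI) (auto simp: emeasure_eq_measure)
    from AE_not_in[OF this] AE_space show "AE \<omega> in M. d < dist (\<rho> (fst p) x \<omega>) (snd p)"
      by eventually_elim (use t(1) in auto)
  qed (rule D(1))
  with continuous_paths[of x]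
  have ae: "AE \<omega> in M. continuous_on {0..} (\<lambda>t. \<rho> t x \<omega>) \<and> (\<forall>p\<in>D. d < dist (\<rho> (fst p) x \<omega>) (snd p))"
    by eventually_elim auto
  have "\<exists>\<omega>\<in>A. continuous_on {0..} (\<lambda>t. \<rho> t x \<omega>) \<and> (\<forall>p\<in>D. d < dist (\<rho> (fst p) x \<omega>) (snd p))"
  proof (rule ccontr)
    assume neg: "\<not> ?thesis"
    from ae have ae': "AE \<omega> in M. \<omega> \<notin> A" by eventually_elim (use neg in blast)
    have "A \<in> sets M" using A measure_notin_sets[of A M] by auto
    from Measure_Space.AE_iff_null_sets[OF this] ae' have "A \<in> null_sets M" by (rule iffD2)
    then show False using A by (simp add: measure_eq_0_null_sets)
  qed
  then obtain \<omega> where \<omega>: "\<omega> \<in> A" "continuous_on {0..} (\<lambda>t. \<rho> t x \<omega>)"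
    "\<And>p. p \<in> D \<Longrightarrow> d < dist (\<rho> (fst p) x \<omega>) (snd p)" by blast
  show ?thesis
  proof (intro bexI[OF _ \<omega>(1)] allI impI)
    fix t assume t: "0 \<le> t" "prob {\<omega> \<in> space M. dist (\<rho> t x \<omega>) (v t) \<le> d} = 0"
    then have "(t, v t) \<in> closure D" using D(3) by (auto simp: N_def)
    then obtain p where p: "\<And>n. p n \<in> D" "p \<longlonglongrightarrow> (t, v t)"
      unfolding closure_sequential by blast
    have 1: "(\<lambda>n. fst (p n)) \<longlonglongrightarrow> t" "(\<lambda>n. snd (p n)) \<longlonglongrightarrow> v t"
      using tendsto_fst[OF p(2)] tendsto_snd[OF p(2)] by simp_all
    have "0 \<le> fst (p n)" for n using p(1)[of n] D(2) by (auto simp: N_def)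
    then have "(\<lambda>n. \<rho> (fst (p n)) x \<omega>) \<longlonglongrightarrow> \<rho> t x \<omega>"
      using t(1) by (intro continuous_on_tendsto_compose[OF \<omega>(2) 1(1)]) auto
    from tendsto_dist[OF this 1(2)] show "d \<le> dist (\<rho> t x \<omega>) (v t)"
      using \<omega>(3)[OF p(1)] by (intro LIMSEQ_le_const) (auto intro: less_imp_le)
  qed
qed

text \<open>Separate outcomes are chosen for the two points, each with a small integrated distance
  to its deterministic path and each far from that path at its own bad times. If every time in a
  window were bad for one of the points, the two integrals together would be too large.\<close>

lemma common_tube_time:
  assumes sup: "support_property M \<rho>" and K: "compact K" "x \<in> K" "y \<in> K" and d: "0 < d"
  obtains t a b where "0 \<le> t" "dist a b \<le> d"
    "prob {\<omega> \<in> space M. dist (\<rho> t x \<omega>) a \<le> d} > 0"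
    "prob {\<omega> \<in> space M. dist (\<rho> t y \<omega>) b \<le> d} > 0"
proof -
  obtain u :: "real \<Rightarrow> 'x \<Rightarrow> 'x" where
    u: "\<forall>R\<ge>0. \<exists>C :: real \<Rightarrow> real.
        (\<forall>t\<ge>0. 0 \<le> C t) \<and> bounded (C ` {0..}) \<and> antimono_on {0..} C \<and> (C \<longlongrightarrow> 0) at_top \<and>
        (\<forall>K. compact K \<and> diameter K = R \<longrightarrow>
          (\<forall>x\<in>K. \<forall>y\<in>K. \<forall>t\<ge>0. dist (u t x) (u t y) \<le> C t))"
    and tube: "\<forall>x. \<forall>T>0. \<forall>\<delta>>0. measure M {\<omega> \<in> space M.
          integrable (lebesgue_on {0..T}) (\<lambda>t. dist (\<rho> t x \<omega>) (u t x)) \<and>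
          (\<integral>t. dist (\<rho> t x \<omega>) (u t x) \<partial>lebesgue_on {0..T}) \<le> \<delta> / 2} > 0"
    using sup unfolding support_property_def by (elim exE conjE) (erule (1) that)
  have "0 \<le> diameter K" by (rule diameter_ge_0[OF compact_imp_bounded[OF K(1)]])
  from mp[OF spec[OF u, of "diameter K"] this] obtain C :: "real \<Rightarrow> real" where C: "(C \<longlongrightarrow> 0) at_top"
    and "\<forall>K'. compact K' \<and> diameter K' = diameter K \<longrightarrow>
          (\<forall>x\<in>K'. \<forall>y\<in>K'. \<forall>t\<ge>0. dist (u t x) (u t y) \<le> C t)"
    by (elim exE conjE) (erule (1) that)
  then have uC: "dist (u t x) (u t y) \<le> C t" if "0 \<le> t" for t
    using K that by blast
  obtain T0 where T0: "\<And>t. T0 \<le> t \<Longrightarrow> C t < d"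
    using order_tendstoD(2)[OF C d] by (auto simp: eventually_at_top_linorder)
  \<comment> \<open>From time \<open>h\<close> on the deterministic paths are within
    \<open>d\<close> of each other. The window [h, 2h] has length \<open>h\<close>, so failure
    throughout would force the integrals to sum to at least \<open>h * d\<close>; the tolerance
    \<open>h * d / 2\<close> in \<open>support_property\<close> makes each at most
    \<open>h * d / 4\<close>. The \<open>1\<close> ensures that \<open>h\<close> is
    positive.\<close>
  define h where "h = max 1 T0"
  have h: "0 < h" "T0 \<le> h" by (auto simp: h_def)
  let ?A = "\<lambda>x. {\<omega> \<in> space M.
          integrable (lebesgue_on {0..2*h}) (\<lambda>t. dist (\<rho> t x \<omega>) (u t x)) \<and>
          (\<integral>t. dist (\<rho> t x \<omega>) (u t x) \<partial>lebesgue_on {0..2*h}) \<le> (h * d / 2) / 2}"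
  have pos: "measure M (?A z) > 0" for z using h d by (intro tube[rule_format]) auto
  from avoiding_path[OF pos, of x x "\<lambda>t. u t x" d]
  obtain \<omega> where \<omega>: "\<omega> \<in> ?A x" "\<forall>t\<ge>0. prob {\<omega> \<in> space M. dist (\<rho> t x \<omega>) (u t x) \<le> d} = 0
    \<longrightarrow> d \<le> dist (\<rho> t x \<omega>) (u t x)" by (rule bexE)
  from avoiding_path[OF pos, of y y "\<lambda>t. u t y" d]
  obtain \<omega>' where \<omega>': "\<omega>' \<in> ?A y" "\<forall>t\<ge>0. prob {\<omega> \<in> space M. dist (\<rho> t y \<omega>) (u t y) \<le> d} = 0
    \<longrightarrow> d \<le> dist (\<rho> t y \<omega>') (u t y)" by (rule bexE)
  have "\<exists>t\<in>{h..2*h}. prob {\<omega> \<in> space M. dist (\<rho> t x \<omega>) (u t x) \<le> d} \<noteq> 0 \<and>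
      prob {\<omega> \<in> space M. dist (\<rho> t y \<omega>) (u t y) \<le> d} \<noteq> 0"
  proof (rule ccontr)
    assume neg: "\<not> ?thesis"
    let ?L = "lebesgue_on {0..2*h}"
    have ind: "has_bochner_integral ?L (indicator {h..2*h}) (measure ?L {h..2*h})"
      using h by (intro has_bochner_integral_real_indicator)
        (auto simp: sets_restrict_space_iff emeasure_restrict_space)
    have "measure ?L {h..2*h} = h" using h by (simp add: measure_restrict_space)
    then have "d * h = (\<integral>t. d * indicator {h..2*h} t \<partial>?L)"
      using has_bochner_integral_integral_eq[OF ind] by simp
    also have "\<dots> \<le> (\<integral>t. dist (\<rho> t x \<omega>) (u t x) + dist (\<rho> t y \<omega>') (u t y) \<partial>?L)"
    proof (rule integral_mono)
      show "integrable ?L (\<lambda>t. d * indicator {h..2*h} t)"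
        using ind by (auto simp: has_bochner_integral_iff)
      show "integrable ?L (\<lambda>t. dist (\<rho> t x \<omega>) (u t x) + dist (\<rho> t y \<omega>') (u t y))"
        using \<omega>(1) \<omega>'(1) by auto
      fix t
      show "d * indicator {h..2*h} t \<le> dist (\<rho> t x \<omega>) (u t x) + dist (\<rho> t y \<omega>') (u t y)"
      proof (cases "t \<in> {h..2*h}")
        case True
        then have "0 \<le> t" using h by simp
        then have "d \<le> dist (\<rho> t x \<omega>) (u t x) \<or> d \<le> dist (\<rho> t y \<omega>') (u t y)"
          using True neg \<omega>(2) \<omega>'(2) by blast
        then show ?thesis using True by (auto intro: add_increasing add_increasing2)
      qed simp
    qed
    also have "\<dots> = (\<integral>t. dist (\<rho> t x \<omega>) (u t x) \<partial>?L) + (\<integral>t. dist (\<rho> t y \<omega>') (u t y) \<partial>?L)"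
      using \<omega>(1) \<omega>'(1) by (intro Bochner_Integration.integral_add) auto
    also have "\<dots> \<le> (h * d / 2) / 2 + (h * d / 2) / 2"
      using \<omega>(1) \<omega>'(1) by (intro add_mono) auto
    finally show False using h d by simp
  qed
  then obtain t where t: "t \<in> {h..2*h}" "prob {\<omega> \<in> space M. dist (\<rho> t x \<omega>) (u t x) \<le> d} \<noteq> 0"
    "prob {\<omega> \<in> space M. dist (\<rho> t y \<omega>) (u t y) \<le> d} \<noteq> 0" by blast
  show ?thesis
  proof (rule that[of t "u t x" "u t y"])
    show "dist (u t x) (u t y) \<le> d" using uC[of t] T0[of t] t(1) h by auto
  qed (use t h in \<open>auto simp: zero_less_measure_iff\<close>)
qed

end

section \<open>Asymptotic stability\<close>

locale ergodic_process = non_expansive_process M F \<rho>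
  for M :: "'w measure" and F :: "ennreal \<Rightarrow> 'w measure"
    and \<rho> :: "real \<Rightarrow> 'x::{metric_space, second_countable_topology} \<Rightarrow> 'w \<Rightarrow> 'x" +
  assumes support: "support_property M \<rho>"
    and dissipation: "dissipation_estimate M \<rho>"
begin

lemma prob_process_complement:
  assumes "0 \<le> t" "K \<in> sets borel"
  shows "prob {\<omega> \<in> space M. \<rho> t x \<omega> \<in> K} = 1 - prob {\<omega> \<in> space M. \<rho> t x \<omega> \<notin> K}"
proof -
  note [measurable] = measurable_rho[OF assms(1)] assms(2)
  have "space M - {\<omega> \<in> space M. \<rho> t x \<omega> \<notin> K} = {\<omega> \<in> space M. \<rho> t x \<omega> \<in> K}" by auto
  moreover have "{\<omega> \<in> space M. \<rho> t x \<omega> \<notin> K} \<in> sets M" by measurable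
  ultimately show ?thesis using prob_compl by metis
qed

text \<open>Let \<open>S\<close> be the supremum of the limiting gap.  On a compact set \<open>K\<close> its maximum is smaller than \<open>S\<close>,
  because two points of \<open>K\<close> come close with positive probability.  Since \<open>K\<close> is the same for all
  starting points and is visited simultaneously with probability at least \<open>1 / 4\<close>, the gap stays below
  \<open>S\<close> uniformly.\<close>

lemma limit_gap_eq_0:
  assumes f: "bdd_lipschitz f"
  shows "limit_gap f x y = 0"
proof (rule ccontr)
  obtain B where B: "0 \<le> B" "\<And>x. \<bar>f x\<bar> \<le> B" "\<And>x y. \<bar>f x - f y\<bar> \<le> B * dist x y"
    using f by (rule bdd_lipschitzE) blast
  note bounds = limit_gap_bounds[OF B]
  define S where "S = (SUP p. limit_gap f (fst p) (snd p))"
  have "bdd_above (range (\<lambda>p. limit_gap f (fst p) (snd p)))"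
    using bounds(2) by (intro bdd_aboveI2)
  then have S: "limit_gap f x y \<le> S" for x y
    unfolding S_def using cSUP_upper[of "(x, y)" UNIV "\<lambda>p. limit_gap f (fst p) (snd p)"] by simp
  assume "limit_gap f x y \<noteq> 0"
  then have S_pos: "0 < S" using bounds(1)[of x y] S[of x y] by linarith
  obtain K where K: "compact K" and ret: "\<And>x y a. 0 \<le> a \<Longrightarrow> \<exists>s\<ge>0.
      prob {\<omega> \<in> space M. \<rho> s x \<omega> \<notin> K} \<le> 1/2 \<and> prob {\<omega> \<in> space M. \<rho> (s + a) y \<omega> \<notin> K} \<le> 1/2"
    using common_return_times[OF dissipation, of "1/2"] by auto
  have K_borel: "K \<in> sets borel" using K by (rule borel_compact)
  \<comment> \<open>For empty \<open>K\<close> the process would be outside with probability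
    \<open>1\<close>, which exceeds \<open>1/2\<close>.\<close>
  have "K \<noteq> {}" using ret[of 0 x x] by (auto simp: prob_space)
  then obtain p where p: "p \<in> K \<times> K"
    "\<forall>q\<in>K \<times> K. (case q of (x, y) \<Rightarrow> limit_gap f x y) \<le> (case p of (x, y) \<Rightarrow> limit_gap f x y)"
    using continuous_attains_sup[OF compact_Times[OF K K] _ continuous_limit_gap[OF B]] by blast
  obtain x1 y1 where xy: "p = (x1, y1)" by (rule prod.exhaust)
  have xK: "x1 \<in> K" "y1 \<in> K" and max: "\<And>x y. x \<in> K \<Longrightarrow> y \<in> K \<Longrightarrow> limit_gap f x y \<le> limit_gap f x1 y1"
    using p xy by auto
  have strict: "limit_gap f x1 y1 < S"
  proof -
    \<comment> \<open>Points in the two balls are at most \<open>3 * d\<close> apart: two radii and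
      the distance of the centres. The Lipschitz bound then keeps their gap at \<open>S / 2\<close>
      or less; \<open>B + 1\<close> avoids division by zero.\<close>
    define d where "d = S / (6 * (B + 1))"
    have d: "0 < d" "B * (3 * d) \<le> S / 2"
      using S_pos B(1) by (auto simp: d_def field_simps)
    obtain t a b where t: "0 \<le> t" "dist a b \<le> d"
      "prob {\<omega> \<in> space M. dist (\<rho> t x1 \<omega>) a \<le> d} > 0"
      "prob {\<omega> \<in> space M. dist (\<rho> t y1 \<omega>) b \<le> d} > 0"
      by (rule common_tube_time[OF support K xK d(1)])
    have "limit_gap f x1 y1 \<le> S - S / 2 * (prob {\<omega> \<in> space M. \<rho> t x1 \<omega> \<in> {z. dist z a \<le> d}} *
        prob {\<omega> \<in> space M. \<rho> t y1 \<omega> \<in> {z. dist z b \<le> d}})"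
    proof (rule limit_gap_contraction[OF B t(1) _ _ S])
      show "{z. dist z a \<le> d} \<in> sets borel" for a :: 'x
        by (intro borel_closed closed_Collect_le continuous_intros)
      then show "{z. dist z b \<le> d} \<in> sets borel" .
      fix p q assume pq: "p \<in> {z. dist z a \<le> d}" "q \<in> {z. dist z b \<le> d}"
      have "dist p q \<le> dist p a + dist a b + dist q b"
        using dist_triangle[of p q a] dist_triangle[of a q b] by (simp add: dist_commute)
      also have "\<dots> \<le> 3 * d" using pq t(2) by simp
      finally have "B * dist p q \<le> B * (3 * d)" using B(1) by (intro mult_left_mono)
      then show "limit_gap f p q \<le> S - S / 2" using d(2) bounds(3)[of p q] by simp
    qed
    moreover have "0 < S / 2 * (prob {\<omega> \<in> space M. \<rho> t x1 \<omega> \<in> {z. dist z a \<le> d}} *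
        prob {\<omega> \<in> space M. \<rho> t y1 \<omega> \<in> {z. dist z b \<le> d}})"
      using S_pos t by (intro mult_pos_pos) auto
    ultimately show ?thesis by linarith
  qed
  define c where "c = S - limit_gap f x1 y1"
  have c: "0 < c" using strict by (simp add: c_def)
  have "limit_gap f x y \<le> S - c / 4" for x y
  proof -
    obtain s where s: "0 \<le> s" "prob {\<omega> \<in> space M. \<rho> s x \<omega> \<notin> K} \<le> 1/2"
      "prob {\<omega> \<in> space M. \<rho> s y \<omega> \<notin> K} \<le> 1/2"
      using ret[of 0 x y] by auto
    have "limit_gap f x y
        \<le> S - c * (prob {\<omega> \<in> space M. \<rho> s x \<omega> \<in> K} * prob {\<omega> \<in> space M. \<rho> s y \<omega> \<in> K})"
      using max by (intro limit_gap_contraction[OF B s(1) K_borel K_borel S]) (auto simp: c_def)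
    moreover have "c * (1/2 * (1/2))
        \<le> c * (prob {\<omega> \<in> space M. \<rho> s x \<omega> \<in> K} * prob {\<omega> \<in> space M. \<rho> s y \<omega> \<in> K})"
      using s c by (intro mult_left_mono mult_mono)
        (auto simp: prob_process_complement[OF s(1) K_borel])
    ultimately show ?thesis by simp
  qed
  then have "S \<le> S - c / 4" unfolding S_def by (intro cSUP_least) auto
  then show False using c by simp
qed

lemma semigroup_diff_tendsto_0:
  assumes f: "bdd_lipschitz f"
  shows "((\<lambda>t. semigroup t f x - semigroup t f y) \<longlongrightarrow> 0) at_top"
proof (rule tendstoI)
  fix e :: real assume e: "0 < e"
  obtain B where B: "0 \<le> B" "\<And>x. \<bar>f x\<bar> \<le> B" "\<And>x y. \<bar>f x - f y\<bar> \<le> B * dist x y"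
    using f by (rule bdd_lipschitzE) blast
  have "(\<lambda>n. gap f (real n) x y) \<longlonglongrightarrow> 0"
    using gap_tendsto[OF B, of x y] limit_gap_eq_0[OF f, of x y] by simp
  from order_tendstoD(2)[OF this e] obtain n where n: "gap f (real n) x y < e"
    by (auto simp: eventually_sequentially)
  have "dist (semigroup t f x - semigroup t f y) 0 < e" if "real n \<le> t" for t
    using gap_upper[OF B _ that, of x y] n by (simp add: dist_real_def)
  then show "\<forall>\<^sub>F t in at_top. dist (semigroup t f x - semigroup t f y) 0 < e"
    unfolding eventually_at_top_linorder by blast
qed

text \<open>This is where monotonicity of \<open>gap\<close> in time pays off: Dini's theorem
  applies to it, although the differences of the semigroup themselves need not be monotone.\<close>

lemma semigroup_diff_uniform_on_compact:
  assumes f: "bdd_lipschitz f" and K: "compact K" and e: "0 < e"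
  shows "\<exists>n. \<forall>t\<ge>real n. \<forall>z\<in>K. \<bar>semigroup t f z - semigroup t f x\<bar> < e"
proof -
  obtain B where B: "0 \<le> B" "\<And>x. \<bar>f x\<bar> \<le> B" "\<And>x y. \<bar>f x - f y\<bar> \<le> B * dist x y"
    using f by (rule bdd_lipschitzE) blast
  have "\<exists>N. \<forall>n\<ge>N. \<forall>z\<in>K. gap f (real n) z x < e"
  proof (rule dini_compact[OF K _ _ _ e])
    show "continuous_on UNIV (\<lambda>z. gap f (real n) z x)" for n
      using continuous_on_compose2[OF continuous_gap[OF B, of "real n" UNIV], of UNIV "\<lambda>z. (z, x)"]
      by (simp add: continuous_on_Pair)
    show "gap f (real n) z x \<le> gap f (real m) z x" if "m \<le> n" for m n z
      using that by (intro gap_antimono[OF B]) auto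
    show "(\<lambda>n. gap f (real n) z x) \<longlonglongrightarrow> 0" for z
      using gap_tendsto[OF B, of z x] limit_gap_eq_0[OF f, of z x] by simp
  qed
  then obtain N where N: "\<forall>z\<in>K. gap f (real N) z x < e" by blast
  have "\<bar>semigroup t f z - semigroup t f x\<bar> < e" if "real N \<le> t" "z \<in> K" for t z
    using gap_upper[OF B _ that(1), of z x] N that(2) by (force intro: le_less_trans)
  then show ?thesis by blast
qed

text \<open>Running the process first for a time at which it sits in a compact set \<open>K\<close> hardly changes the late
  value of the semigroup.  Late times \<open>t \<le> t'\<close> are compared through \<open>s + t' = (s + a) + t\<close>, where
  \<open>a = t' - t\<close> and the process sits in \<open>K\<close> both at time \<open>s\<close> and at time \<open>s + a\<close>.\<close>

lemma semigroup_Cauchy: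
  assumes f: "bdd_lipschitz f" and e: "0 < e"
  shows "\<exists>n. \<forall>t\<ge>real n. \<forall>t'\<ge>real n. \<bar>semigroup t f x - semigroup t' f x\<bar> \<le> e"
proof -
  obtain B where B: "0 \<le> B" "\<And>x. \<bar>f x\<bar> \<le> B" "\<And>x y. \<bar>f x - f y\<bar> \<le> B * dist x y"
    using f by (rule bdd_lipschitzE) blast
  \<comment> \<open>Two comparisons are made, each costing \<open>d\<close> on \<open>K\<close> and
    at most \<open>2 * B\<close> on an event of probability \<open>d\<close>; the total is
    \<open>e\<close>.\<close>
  define d where "d = e / (2 + 4 * B)"
  have "d * (2 + 4 * B) = e" "0 < d" using e B(1) by (simp_all add: d_def)
  then have d: "0 < d" "2 * (d + 2 * B * d) = e" by (simp_all add: algebra_simps)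
  obtain K where K: "compact K" and ret: "\<And>x y a. 0 \<le> a \<Longrightarrow> \<exists>s\<ge>0.
      prob {\<omega> \<in> space M. \<rho> s x \<omega> \<notin> K} \<le> d \<and> prob {\<omega> \<in> space M. \<rho> (s + a) y \<omega> \<notin> K} \<le> d"
    using common_return_times[OF dissipation d(1)] by auto
  have K_borel: "K \<in> sets borel" using K by (rule borel_compact)
  obtain n where n: "\<And>t z. real n \<le> t \<Longrightarrow> z \<in> K \<Longrightarrow> \<bar>semigroup t f z - semigroup t f x\<bar> < d"
    using semigroup_diff_uniform_on_compact[OF f K d(1)] by blast
  have step: "\<bar>semigroup (s + r) f x - semigroup r f x\<bar> \<le> d + 2 * B * d"
    if s: "0 \<le> s" "prob {\<omega> \<in> space M. \<rho> s x \<omega> \<notin> K} \<le> d" and r: "real n \<le> r" for s r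
  proof -
    have r0: "0 \<le> r" using r by simp
    define h where "h = semigroup r f"
    have h_bd: "\<bar>h z\<bar> \<le> B" for z unfolding h_def by (rule semigroup_bounds(1)[OF B r0])
    have h_meas: "h \<in> borel_measurable borel"
      unfolding h_def by (intro bdd_lipschitz_measurable bdd_lipschitz_semigroup f r0)
    have h_int: "integrable M (\<lambda>\<omega>. h (\<rho> s x \<omega>))" by (rule integrable_comp_process[OF s(1) h_meas h_bd])
    note [measurable] = measurable_rho[OF s(1)] K_borel
    let ?E = "{\<omega> \<in> space M. \<rho> s x \<omega> \<notin> K}"
    have "semigroup (s + r) f x - semigroup r f x = (\<integral>\<omega>. h (\<rho> s x \<omega>) - h x \<partial>M)"
      using h_int by (simp add: semigroup_add[OF s(1) r0 f] semigroup_def[of s] prob_space flip: h_def)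
    then have "\<bar>semigroup (s + r) f x - semigroup r f x\<bar> \<le> (\<integral>\<omega>. \<bar>h (\<rho> s x \<omega>) - h x\<bar> \<partial>M)"
      by (simp add: integral_abs_bound)
    also have "\<dots> \<le> (\<integral>\<omega>. d + 2 * B * indicator ?E \<omega> \<partial>M)"
    proof (rule integral_mono)
      fix \<omega> assume \<omega>: "\<omega> \<in> space M"
      have "\<bar>h z - h x\<bar> \<le> 2 * B" for z using h_bd[of z] h_bd[of x] by linarith
      then show "\<bar>h (\<rho> s x \<omega>) - h x\<bar> \<le> d + 2 * B * indicator ?E \<omega>"
        using n[OF r, of "\<rho> s x \<omega>"] d(1) \<omega>
        by (cases "\<rho> s x \<omega> \<in> K") (auto simp: h_def intro: add_increasing)
    next
      have "?E \<in> sets M" by measurable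
      then show "integrable M (\<lambda>\<omega>. d + 2 * B * indicator ?E \<omega>)"
        by (simp add: emeasure_eq_measure)
    qed (use h_int in auto)
    also have "\<dots> = d + 2 * B * prob ?E"
      by (simp add: prob_space emeasure_eq_measure)
    also have "\<dots> \<le> d + 2 * B * d"
      using s(2) B(1) by (intro add_left_mono mult_left_mono) auto
    finally show ?thesis .
  qed
  have ordered: "\<bar>semigroup t f x - semigroup t' f x\<bar> \<le> e" if t: "real n \<le> t" "t \<le> t'" for t t'
  proof -
    obtain s where s: "0 \<le> s" "prob {\<omega> \<in> space M. \<rho> s x \<omega> \<notin> K} \<le> d"
      "prob {\<omega> \<in> space M. \<rho> (s + (t' - t)) x \<omega> \<notin> K} \<le> d"
      using ret[of "t' - t" x x] t by auto
    have "s + (t' - t) + t = s + t'" by simp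
    then show ?thesis
      using step[OF s(1,2), of t'] step[OF _ s(3), of t] s(1) t d(2) by auto
  qed
  have "\<bar>semigroup t f x - semigroup t' f x\<bar> \<le> e" if "real n \<le> t" "real n \<le> t'" for t t'
    using that ordered[of t t'] ordered[of t' t] by (cases "t \<le> t'") (simp_all add: abs_minus_commute)
  then show ?thesis by blast
qed

text \<open>The limit turns out not to depend on the starting point, so \<open>undefined\<close>
  just names one.\<close>

definition mean :: "('x \<Rightarrow> real) \<Rightarrow> real" where
  "mean f = Lim at_top (\<lambda>t. semigroup t f undefined)"

text \<open>Completeness of the reals is used along integer times, the Cauchy bound over real times
  extends the limit to all times, and \<open>semigroup_diff_tendsto_0\<close> moves the starting
  point.\<close>

lemma semigroup_tendsto_mean:
  assumes f: "bdd_lipschitz f"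
  shows "((\<lambda>t. semigroup t f x) \<longlongrightarrow> mean f) at_top"
proof -
  let ?X = "\<lambda>t. semigroup t f undefined"
  have "Cauchy (\<lambda>n::nat. ?X (real n))"
  proof (rule CauchyI')
    fix e :: real assume e: "0 < e"
    from semigroup_Cauchy[OF f half_gt_zero[OF e]]
    obtain n :: nat where n: "\<forall>t\<ge>real n. \<forall>t'\<ge>real n. \<bar>?X t - ?X t'\<bar> \<le> e / 2" ..
    have "dist (?X (real k)) (?X (real m)) < e" if "n \<le> k" "k < m" for k m
    proof -
      have "\<bar>?X (real k) - ?X (real m)\<bar> \<le> e / 2" using n that by simp
      then show ?thesis using e by (simp add: dist_real_def)
    qed
    then show "\<exists>n. \<forall>k\<ge>n. \<forall>m>k. dist (?X (real k)) (?X (real m)) < e"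
      by (intro exI[of _ n]) simp
  qed
  then obtain l where l: "(\<lambda>n::nat. ?X (real n)) \<longlonglongrightarrow> l"
    using Cauchy_convergent convergent_def by blast
  have "(?X \<longlongrightarrow> l) at_top"
  proof (rule tendstoI)
    fix e :: real assume e: "0 < e"
    from semigroup_Cauchy[OF f half_gt_zero[OF e]]
    obtain n :: nat where n: "\<forall>t\<ge>real n. \<forall>t'\<ge>real n. \<bar>?X t - ?X t'\<bar> \<le> e / 2" ..
    have "dist (?X t) l < e" if t: "real n \<le> t" for t
    proof -
      have "(\<lambda>m. \<bar>?X t - ?X (real m)\<bar>) \<longlonglongrightarrow> \<bar>?X t - l\<bar>" by (intro tendsto_intros l)
      then have "\<bar>?X t - l\<bar> \<le> e / 2"
        by (rule LIMSEQ_le_const2) (use n t in \<open>auto intro!: exI[of _ n]\<close>)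
      then show ?thesis using e by (simp add: dist_real_def)
    qed
    then show "\<forall>\<^sub>F t in at_top. dist (?X t) l < e"
      unfolding eventually_at_top_linorder by blast
  qed
  then have "(?X \<longlongrightarrow> mean f) at_top"
    unfolding mean_def using tendsto_Lim[OF trivial_limit_at_top_linorder] by metis
  from tendsto_add[OF semigroup_diff_tendsto_0[OF f, of x undefined] this] show ?thesis by simp
qed

lemma mean_eqI: "bdd_lipschitz f \<Longrightarrow> ((\<lambda>t. semigroup t f x) \<longlongrightarrow> l) at_top \<Longrightarrow> mean f = l"
  by (rule tendsto_unique[OF trivial_limit_at_top_linorder semigroup_tendsto_mean])

text \<open>Invariance at the level of functionals: it only shifts the time that tends to
  infinity.\<close>

lemma mean_semigroup:
  assumes f: "bdd_lipschitz f" and t: "0 \<le> t"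
  shows "mean (semigroup t f) = mean f"
proof (rule mean_eqI[OF bdd_lipschitz_semigroup[OF t f]])
  have "((\<lambda>s. semigroup (s + t) f undefined) \<longlongrightarrow> mean f) at_top"
    by (rule filterlim_compose[OF semigroup_tendsto_mean[OF f]])
       (rule filterlim_tendsto_add_at_top[OF tendsto_const filterlim_ident, of t, simplified add.commute])
  then show "((\<lambda>s. semigroup s (semigroup t f) undefined) \<longlongrightarrow> mean f) at_top"
    by (rule Lim_transform_eventually)
       (auto intro!: eventually_mono[OF eventually_ge_at_top[of 0]] semigroup_add t f)
qed

text \<open>Linearity and positivity pass to the limit. For tightness it is enough that the process
  is in \<open>K\<close> with high probability at arbitrarily late times, because the limit of the
  semigroup is already known to exist.\<close>

sublocale stationary: tight_functional mean
proof
  fix f g :: "'x \<Rightarrow> real" and c e :: real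
  assume f: "bdd_lipschitz f"
  have int: "integrable M (\<lambda>\<omega>. f (\<rho> t x \<omega>))" if t: "0 \<le> t" and f: "bdd_lipschitz f" for t x and f :: "'x \<Rightarrow> real"
  proof -
    obtain B where "\<And>x. \<bar>f x\<bar> \<le> B" using f by (rule bdd_lipschitzE) blast
    then show ?thesis by (rule integrable_comp_process[OF t bdd_lipschitz_measurable[OF f]])
  qed
  show "mean (\<lambda>x. f x + g x) = mean f + mean g" if g: "bdd_lipschitz g"
  proof (rule mean_eqI[OF bdd_lipschitz_add[OF f g]])
    show "((\<lambda>t. semigroup t (\<lambda>x. f x + g x) undefined) \<longlongrightarrow> mean f + mean g) at_top"
      by (rule Lim_transform_eventually[OF tendsto_add[OF semigroup_tendsto_mean[OF f] semigroup_tendsto_mean[OF g]]])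
         (auto intro!: eventually_mono[OF eventually_ge_at_top[of 0]] simp: semigroup_def int f g)
  qed
  show "mean (\<lambda>x. c * f x) = c * mean f"
  proof (rule mean_eqI[OF bdd_lipschitz_cmult[OF f]])
    show "((\<lambda>t. semigroup t (\<lambda>x. c * f x) undefined) \<longlongrightarrow> c * mean f) at_top"
      using tendsto_mult_left[OF semigroup_tendsto_mean[OF f], of c] by (simp add: semigroup_def)
  qed
  show "0 \<le> mean f" if "\<And>x. 0 \<le> f x"
    by (rule tendsto_lowerbound[OF semigroup_tendsto_mean[OF f]])
       (auto simp: semigroup_def that)
next
  show "mean (\<lambda>_. 1) = 1"
    by (rule mean_eqI[OF bdd_lipschitz_const]) (simp add: semigroup_def prob_space)
next
  fix e :: real assume e: "0 < e"
  obtain K where K: "compact K" and ret: "\<And>x y a. 0 \<le> a \<Longrightarrow> \<exists>s\<ge>0.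
      prob {\<omega> \<in> space M. \<rho> s x \<omega> \<notin> K} \<le> e \<and> prob {\<omega> \<in> space M. \<rho> (s + a) y \<omega> \<notin> K} \<le> e"
    using common_return_times[OF dissipation e] by auto
  have K_borel: "K \<in> sets borel" using K by (rule borel_compact)
  have "mean f \<le> e"
    if f: "bdd_lipschitz f" and f01: "\<And>x. 0 \<le> f x \<and> f x \<le> 1" and f0: "\<And>x. x \<in> K \<Longrightarrow> f x = 0" for f
  proof (rule ccontr)
    assume "\<not> mean f \<le> e"
    then have "\<forall>\<^sub>F t in at_top. e < semigroup t f undefined"
      by (intro order_tendstoD(1)[OF semigroup_tendsto_mean[OF f]]) simp
    then obtain N where N: "\<And>t. N \<le> t \<Longrightarrow> e < semigroup t f undefined"
      by (auto simp: eventually_at_top_linorder)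
    \<comment> \<open>The shift serves here to push a return time beyond \<open>N\<close>.\<close>
    obtain s where s: "0 \<le> s" "prob {\<omega> \<in> space M. \<rho> (s + max 0 N) undefined \<omega> \<notin> K} \<le> e"
      using ret[of "max 0 N" undefined undefined] by auto
    define t where "t = s + max 0 N"
    have t: "0 \<le> t" "N \<le> t" using s(1) by (auto simp: t_def)
    note [measurable] = measurable_rho[OF t(1)] K_borel bdd_lipschitz_measurable[OF f]
    have "semigroup t f undefined
        \<le> (\<integral>\<omega>. indicator {\<omega> \<in> space M. \<rho> t undefined \<omega> \<notin> K} \<omega> \<partial>M)"
      unfolding semigroup_def
    proof (rule integral_mono)
      show "integrable M (\<lambda>\<omega>. f (\<rho> t undefined \<omega>))"
        using f01 by (intro integrable_const_bound[where B=1]) auto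
      show "f (\<rho> t undefined \<omega>) \<le> indicator {\<omega> \<in> space M. \<rho> t undefined \<omega> \<notin> K} \<omega>"
        if "\<omega> \<in> space M" for \<omega>
        using f01[of "\<rho> t undefined \<omega>"] f0[of "\<rho> t undefined \<omega>"] that by (auto simp: indicator_def)
    qed (simp add: emeasure_eq_measure)
    also have "\<dots> = prob {\<omega> \<in> space M. \<rho> t undefined \<omega> \<notin> K}"
      by (simp add: Int_absorb2 Collect_restrict)
    also have "\<dots> \<le> e" using s(2) by (simp add: t_def)
    finally show False using N[OF t(2)] by simp
  qed
  then show "\<exists>K. compact K \<and> (\<forall>f. bdd_lipschitz f \<longrightarrow> (\<forall>x. 0 \<le> f x \<and> f x \<le> 1) \<longrightarrow>
      (\<forall>x\<in>K. f x = 0) \<longrightarrow> mean f \<le> e)"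
    by (intro exI[of _ K]) (simp add: K)
qed

section \<open>Mixing, invariance and uniqueness\<close>

lemma riesz_measure_prob_algebra: "stationary.riesz_measure \<in> space (prob_algebra borel)"
  by (simp add: space_prob_algebra stationary.prob_space_riesz_measure)

lemma dual_semigroup_prob_algebra:
  assumes "0 \<le> t" "\<mu> \<in> space (prob_algebra borel)"
  shows "dual_semigroup M \<rho> t \<mu> \<in> space (prob_algebra borel)"
  using prob_space_bind'[OF assms(2) measurable_transition[OF non_expansive assms(1)]]
    sets_bind'[OF assms(2) measurable_transition[OF non_expansive assms(1)]]
  by (simp add: dual_semigroup_def space_prob_algebra)

lemma integral_dual_semigroup_bdd_lipschitz:
  assumes "0 \<le> t" "\<mu> \<in> space (prob_algebra borel)" "bdd_lipschitz f"
  shows "(\<integral>y. f y \<partial>dual_semigroup M \<rho> t \<mu>) = (\<integral>x. semigroup t f x \<partial>\<mu>)"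
  using integral_dual_semigroup[OF non_expansive assms(1,2) bdd_lipschitz_measurable bdd_lipschitz_bounded] assms(3)
  by (simp add: semigroup_def)

text \<open>The semigroup converges to the same constant from every starting point, and it is
  uniformly bounded, so dominated convergence handles every initial law at once.\<close>

lemma dual_semigroup_weakly_converges:
  assumes \<mu>: "\<mu> \<in> space (prob_algebra borel)"
  shows "weakly_converges (\<lambda>t. dual_semigroup M \<rho> t \<mu>) stationary.riesz_measure at_top"
proof (rule weakly_converges_bdd_lipschitzI)
  show "\<forall>\<^sub>F t in at_top. dual_semigroup M \<rho> t \<mu> \<in> space (prob_algebra borel)"
    by (rule eventually_mono[OF eventually_ge_at_top[of 0]]) (rule dual_semigroup_prob_algebra[OF _ \<mu>])
  show "stationary.riesz_measure \<in> space (prob_algebra borel)" by (rule riesz_measure_prob_algebra)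
  fix f :: "'x \<Rightarrow> real" assume f: "bdd_lipschitz f"
  interpret \<mu>: prob_space \<mu> by (rule prob_algebra_borelD[OF \<mu>])
  obtain B where B: "0 \<le> B" "\<And>x. \<bar>f x\<bar> \<le> B" "\<And>x y. \<bar>f x - f y\<bar> \<le> B * dist x y"
    using f by (rule bdd_lipschitzE) blast
  \<comment> \<open>Dominated convergence asks for measurability at every real \<open>t\<close>, so
    negative times are replaced by \<open>0\<close>.\<close>
  define P where "P t = semigroup (max 0 t) f" for t
  have P_lim: "((\<lambda>t. P t x) \<longlongrightarrow> mean f) at_top" for x
    unfolding P_def using semigroup_tendsto_mean[OF f]
    by (rule Lim_transform_eventually)
       (auto intro!: eventually_mono[OF eventually_ge_at_top[of 0]] simp: max_def)
  have "((\<lambda>t. \<integral>x. P t x \<partial>\<mu>) \<longlongrightarrow> (\<integral>x. mean f \<partial>\<mu>)) at_top"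
  proof (rule integral_dominated_convergence_at_top[where w="\<lambda>_. B"])
    show "P t \<in> borel_measurable \<mu>" for t
      using bdd_lipschitz_measurable[OF bdd_lipschitz_semigroup[OF _ f, of "max 0 t"]]
        prob_algebra_borelD(2)[OF \<mu>]
      by (simp add: P_def cong: measurable_cong_sets)
    show "\<forall>\<^sub>F t in at_top. AE x in \<mu>. norm (P t x) \<le> B"
      using semigroup_bounds(1)[OF B] by (auto simp: P_def)
  qed (use P_lim in auto)
  then have "((\<lambda>t. \<integral>x. P t x \<partial>\<mu>) \<longlongrightarrow> (\<integral>x. f x \<partial>stationary.riesz_measure)) at_top"
    by (simp add: stationary.riesz_representation[OF f] \<mu>.prob_space)
  then show "((\<lambda>t. \<integral>x. f x \<partial>dual_semigroup M \<rho> t \<mu>) \<longlongrightarrow> (\<integral>x. f x \<partial>stationary.riesz_measure)) at_top"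
    by (rule Lim_transform_eventually)
       (auto intro!: eventually_mono[OF eventually_ge_at_top[of 0]]
         simp: P_def integral_dual_semigroup_bdd_lipschitz[OF _ \<mu> f])
qed

text \<open>An invariant measure is the limit of its own constant orbit, so mixing identifies it.
  Conversely, \<open>mean_semigroup\<close> and the representation show that the dual semigroup
  preserves all integrals of Lipschitz functions.\<close>

lemma invariant_prob_iff: "invariant_prob M \<rho> \<mu> \<longleftrightarrow> \<mu> = stationary.riesz_measure"
proof
  assume inv: "invariant_prob M \<rho> \<mu>"
  then have \<mu>: "\<mu> \<in> space (prob_algebra borel)" by (simp add: invariant_prob_def)
  show "\<mu> = stationary.riesz_measure"
  proof (rule prob_measure_eqI_bdd_lipschitz[OF \<mu> riesz_measure_prob_algebra])
    fix f :: "'x \<Rightarrow> real" assume f: "bdd_lipschitz f"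
    have "((\<lambda>t. \<integral>x. f x \<partial>dual_semigroup M \<rho> t \<mu>) \<longlongrightarrow> (\<integral>x. f x \<partial>stationary.riesz_measure)) at_top"
      using dual_semigroup_weakly_converges[OF \<mu>] bdd_lipschitz_continuous_on[OF f] bdd_lipschitz_bounded[OF f]
      by (simp add: weakly_converges_def)
    moreover have "((\<lambda>t. \<integral>x. f x \<partial>dual_semigroup M \<rho> t \<mu>) \<longlongrightarrow> (\<integral>x. f x \<partial>\<mu>)) at_top"
      by (rule tendsto_eventually)
         (use inv in \<open>auto intro!: eventually_mono[OF eventually_ge_at_top[of 0]] simp: invariant_prob_def\<close>)
    ultimately show "(\<integral>x. f x \<partial>\<mu>) = (\<integral>x. f x \<partial>stationary.riesz_measure)"
      by (rule tendsto_unique[OF trivial_limit_at_top_linorder, rotated])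
  qed
next
  have "dual_semigroup M \<rho> t stationary.riesz_measure = stationary.riesz_measure" if t: "0 \<le> t" for t
  proof (rule prob_measure_eqI_bdd_lipschitz)
    show "dual_semigroup M \<rho> t stationary.riesz_measure \<in> space (prob_algebra borel)"
      by (rule dual_semigroup_prob_algebra[OF t riesz_measure_prob_algebra])
    show "(\<integral>x. f x \<partial>dual_semigroup M \<rho> t stationary.riesz_measure) = (\<integral>x. f x \<partial>stationary.riesz_measure)"
      if f: "bdd_lipschitz f" for f
      by (simp add: integral_dual_semigroup_bdd_lipschitz[OF t riesz_measure_prob_algebra f] mean_semigroup[OF f t]
          stationary.riesz_representation bdd_lipschitz_semigroup t f)
  qed (rule riesz_measure_prob_algebra)
  then show "\<mu> = stationary.riesz_measure \<Longrightarrow> invariant_prob M \<rho> \<mu>"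
    by (simp add: invariant_prob_def riesz_measure_prob_algebra)
qed

end

theorem theorem5p9:
  fixes M :: "'w measure" and F :: "ennreal \<Rightarrow> 'w measure"
    and \<rho> :: "real \<Rightarrow> 'x::{metric_space, second_countable_topology} \<Rightarrow> 'w \<Rightarrow> 'x"
  assumes process: "markov_process M F \<rho>"
    and H1: "non_expansive M \<rho>"
    and H2: "support_property M \<rho>"
    and H3: "strong_markov M F \<rho>"
    and H4: "dissipation_estimate M \<rho>"
  shows "\<exists>\<mu>s. (\<forall>\<mu>. invariant_prob M \<rho> \<mu> \<longleftrightarrow> \<mu> = \<mu>s) \<and>
           (\<forall>\<mu>\<in>space (prob_algebra borel).
              weakly_converges (\<lambda>t. dual_semigroup M \<rho> t \<mu>) \<mu>s at_top)"
proof -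
  interpret ergodic_process M F \<rho>
    using process H1 H2 H4
    by (simp add: ergodic_process_def non_expansive_process_def
        non_expansive_process_axioms_def ergodic_process_axioms_def)
  show ?thesis
    using invariant_prob_iff dual_semigroup_weakly_converges by blast
qed

end
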